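(* For each integer $n\ge 1$ there exists a Stein manifold of complex dimension $n$ that cannot be holomorphically immersed into $\mathbf{C}^N$ for any $N < \left[\frac{3n}{2}\right]$.
   Context: $[x]$ denotes the greatest integer $\le x$. A holomorphic immersion is a holomorphic map whose complex differential is injective at every point. *)

theory Defs
  imports "HOL-Analysis.Analysis"
begin

text \<open>
  Complex manifolds are given by a topology on a subset of a type together with an atlas of
  charts \<open>(U, \<phi>)\<close>, where \<open>\<phi>\<close> takes values in \<open>complex ^ 'n\<close>; the complex dimension is thus
  \<open>CARD('n)\<close>. Values of a chart outside its domain are irrelevant. Manifolds are Hausdorff and
  second countable, but not assumed to be connected.
\<close>

type_synonym ('a, 'n) chart = "'a set \<times> ('a \<Rightarrow> complex ^ 'n)"

text \<open>
  Complex (Frechet) differentiability at every point of \<open>S\<close>; \<open>S\<close> is meant to be open. Complex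
  linearity of the real derivative encodes the Cauchy-Riemann equations.
\<close>

definition holomorphic_sev_on :: "(complex ^ 'n \<Rightarrow> complex) \<Rightarrow> (complex ^ 'n) set \<Rightarrow> bool"
  where "holomorphic_sev_on f S \<longleftrightarrow>
    (\<forall>z\<in>S. \<exists>f'. (f has_derivative f') (at z) \<and> Vector_Spaces.linear (*s) (*) f')"

definition topological_chart :: "'a topology \<Rightarrow> ('a, 'n::finite) chart \<Rightarrow> bool"
  where "topological_chart X = (\<lambda>(U, \<phi>).
    openin X U \<and> open (\<phi> ` U) \<and>
    homeomorphic_map (subtopology X U) (top_of_set (\<phi> ` U)) \<phi>)"

definition holomorphic_transition :: "('a, 'n::finite) chart \<Rightarrow> ('a, 'n) chart \<Rightarrow> bool"
  where "holomorphic_transition = (\<lambda>(U, \<phi>) (V, \<psi>).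
    \<forall>i. holomorphic_sev_on (\<lambda>z. \<psi> (inv_into U \<phi> z) $ i) (\<phi> ` (U \<inter> V)))"

definition complex_manifold :: "'a topology \<Rightarrow> ('a, 'n::finite) chart set \<Rightarrow> bool"
  where "complex_manifold X A \<longleftrightarrow>
    Hausdorff_space X \<and> second_countable X \<and>
    (\<forall>c\<in>A. topological_chart X c) \<and>
    (\<Union>c\<in>A. fst c) = topspace X \<and>
    (\<forall>c\<in>A. \<forall>d\<in>A. holomorphic_transition c d)"

text \<open>The charts of the maximal atlas containing \<open>A\<close>.\<close>

definition compatible_chart ::
    "'a topology \<Rightarrow> ('a, 'n::finite) chart set \<Rightarrow> ('a, 'n) chart \<Rightarrow> bool"
  where "compatible_chart X A c \<longleftrightarrow> topological_chart X c \<and>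
    (\<forall>d\<in>A. holomorphic_transition c d \<and> holomorphic_transition d c)"

definition holomorphic_functions :: "('a, 'n::finite) chart set \<Rightarrow> ('a \<Rightarrow> complex) set"
  where "holomorphic_functions A =
    {f. \<forall>(U, \<phi>)\<in>A. holomorphic_sev_on (f \<circ> inv_into U \<phi>) (\<phi> ` U)}"

text \<open>The supremum is taken in \<open>ereal\<close>, so that the hull of the empty set is empty.\<close>

definition holomorphic_hull :: "'a topology \<Rightarrow> ('a, 'n::finite) chart set \<Rightarrow> 'a set \<Rightarrow> 'a set"
  where "holomorphic_hull X A K =
    {x \<in> topspace X. \<forall>f\<in>holomorphic_functions A.
       ereal (cmod (f x)) \<le> (SUP y\<in>K. ereal (cmod (f y)))}"

text \<open>
  The classical definition (Hoermander, An Introduction to Complex Analysis in Several Variables,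
  Section 5.1): the manifold is holomorphically convex, global holomorphic functions separate
  points, and near every point some global holomorphic functions form a coordinate system.
\<close>

definition stein_manifold :: "'a topology \<Rightarrow> ('a, 'n::finite) chart set \<Rightarrow> bool"
  where "stein_manifold X A \<longleftrightarrow>
    complex_manifold X A \<and>
    (\<forall>K. compactin X K \<longrightarrow> compactin X (holomorphic_hull X A K)) \<and>
    (\<forall>x\<in>topspace X. \<forall>y\<in>topspace X. x \<noteq> y \<longrightarrow> (\<exists>f\<in>holomorphic_functions A. f x \<noteq> f y)) \<and>
    (\<forall>x\<in>topspace X. \<exists>g. (\<forall>i. g i \<in> holomorphic_functions A) \<and>
       (\<exists>U. x \<in> U \<and> compatible_chart X A (U, \<lambda>y. \<chi> i. g i y)))"

text \<open>
  A map into \<open>N\<close>-dimensional complex space, where \<open>N\<close> may be zero, is a function into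
  \<open>nat \<Rightarrow> complex\<close> of which only the coordinates below \<open>N\<close> matter. Its differential is computed
  in every chart of the atlas.
\<close>

definition holomorphic_immersion ::
    "('a, 'n::finite) chart set \<Rightarrow> nat \<Rightarrow> ('a \<Rightarrow> nat \<Rightarrow> complex) \<Rightarrow> bool"
  where "holomorphic_immersion A N F \<longleftrightarrow>
    (\<forall>k<N. (\<lambda>x. F x k) \<in> holomorphic_functions A) \<and>
    (\<forall>(U, \<phi>)\<in>A. \<forall>x\<in>U.
       inj (\<lambda>h. \<lambda>k\<in>{..<N}.
              frechet_derivative (\<lambda>z. F (inv_into U \<phi> z) k) (at (\<phi> x)) h))"

end

theory Submission
  imports Defs "HOL-Complex_Analysis.Cauchy_Integral_Formula" "HOL-Library.Z2"
begin

text \<open>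
  Let \<open>Y\<close> be the complement of the conic \<open>z \<bullet> z = 0\<close> in the complex projective plane. It contains
  the real projective plane as a totally real submanifold, over which its tangent bundle is the
  complexification of the real one and hence stably the complexified tautological line bundle \<open>L\<close>;
  moreover \<open>2 L\<close> is trivial. For \<open>n = 2 m + p\<close> with \<open>p \<le> 1\<close> take \<open>X = Y\<^sup>m \<times> \<complex>\<^sup>p\<close>. An immersion of
  \<open>X\<close> into \<open>\<complex>\<^sup>N\<close> gives a normal bundle of rank \<open>N - n\<close> which is stably the sum \<open>L\<^sub>1 \<oplus> \<dots> \<oplus> L\<^sub>m\<close>,
  and since the top Chern class of this sum is nonzero modulo 2, \<open>N - n \<ge> m\<close>.

  In elementary terms, if \<open>N - n < m\<close>, the differential of the immersion, extended by the linear maps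
  which realise the stable isomorphisms, is a map without zeros on a product of spheres with values
  in a Euclidean space of the same dimension, each component of which is odd or even in each factor.
  This contradicts a Borsuk-Ulam theorem for products of spheres. To prove the latter, assume that
  the map has no zero and consider on the product of spheres the 0-cochains modulo 2 that record the
  signs of its components. The cup product of their coboundaries vanishes on all small simplices,
  but Stokes' formula on hemispheres evaluates it on the product of the top hemispheres to a
  coefficient of a product of linear forms, one for each component.
\<close>

subsection \<open>A Borsuk-Ulam theorem for products of spheres\<close>

declare add_bit_eq_xor [simp del] mult_bit_eq_and [simp del]

lemma bit_add_self [simp]: "x + x = (0::bit)"
  by (cases x) simp_all

lemma bit_add_self_left [simp]: "x + (x + y) = (y::bit)"
  by (simp add: add.assoc[symmetric])

text \<open>Off the diagonal equal terms cancel in pairs modulo 2. Applied to faces of faces, this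
  is the vanishing of the boundary of a boundary.\<close>

lemma bit_sum_symmetric:
  fixes a :: "'i \<Rightarrow> 'i \<Rightarrow> bit"
  assumes "finite S" "\<And>i j. a i j = a j i" "\<And>i. a i i = 0"
  shows "(\<Sum>i\<in>S. \<Sum>j\<in>S. a i j) = 0"
  using \<open>finite S\<close>
proof induction
  case (insert x S)
  have "(\<Sum>i\<in>S. a i x) = (\<Sum>j\<in>S. a x j)"
    using assms(2) by (intro sum.cong) auto
  with insert assms(3) show ?case
    by (simp add: sum.distrib add.assoc)
qed simp

text \<open>
  Simplices are lists of points, cochains are functions on lists with values in \<open>\<int>/2\<close>, and a
  chain is represented by the functional that evaluates cochains on it. The coboundary is
  augmented: on one-element lists it returns the value at the empty list.
\<close>

primrec cobd :: "('p list \<Rightarrow> bit) \<Rightarrow> 'p list \<Rightarrow> bit" where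
  "cobd \<phi> [] = 0"
| "cobd \<phi> (v # vs) = \<phi> vs + cobd (\<lambda>ws. \<phi> (v # ws)) vs"

lemma cobd_add: "cobd (\<lambda>ws. \<phi> ws + \<psi> ws) vs = cobd \<phi> vs + cobd \<psi> vs"
  by (induction vs arbitrary: \<phi> \<psi>) (auto simp: algebra_simps)

lemma cobd_zero [simp]: "cobd (\<lambda>ws. 0) vs = 0"
  by (induction vs) auto

lemma cobd_mult: "cobd (\<lambda>ws. c * \<phi> ws) vs = c * cobd \<phi> vs"
  by (induction vs arbitrary: \<phi>) (auto simp: algebra_simps)

lemma cobd_sum: "cobd (\<lambda>ws. \<Sum>i\<in>A. \<phi> i ws) vs = (\<Sum>i\<in>A. cobd (\<phi> i) vs)"
  by (induction A rule: infinite_finite_induct) (auto simp: cobd_add)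

lemma cobd_map: "cobd \<phi> (map g vs) = cobd (\<lambda>ws. \<phi> (map g ws)) vs"
  by (induction vs arbitrary: \<phi>) auto

lemma cobd_cobd: "cobd (cobd \<phi>) vs = 0"
  by (induction vs arbitrary: \<phi>) (auto simp: cobd_add)

section \<open>The prism operator\<close>

text \<open>The usual triangulation of a prism: for vertices v_0, ..., v_n the cochain is summed
  over the lists \<alpha> v_0, ..., \<alpha> v_k, \<beta> v_k, ..., \<beta> v_n.\<close>

primrec prism :: "('p \<Rightarrow> 'q) \<Rightarrow> ('p \<Rightarrow> 'q) \<Rightarrow> ('q list \<Rightarrow> bit) \<Rightarrow> 'p list \<Rightarrow> bit" where
  "prism \<alpha> \<beta> \<phi> [] = 0"
| "prism \<alpha> \<beta> \<phi> (v # vs) =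
     \<phi> (\<alpha> v # \<beta> v # map \<beta> vs) + prism \<alpha> \<beta> (\<lambda>ws. \<phi> (\<alpha> v # ws)) vs"

lemma prism_add: "prism \<alpha> \<beta> (\<lambda>ws. \<phi> ws + \<psi> ws) vs = prism \<alpha> \<beta> \<phi> vs + prism \<alpha> \<beta> \<psi> vs"
  by (induction vs arbitrary: \<phi> \<psi>) (auto simp: algebra_simps)

text \<open>This is the chain homotopy formula between the images under \<alpha> and \<beta>. The
  inner walls of the prism cancel, and modulo 2 there are no signs.\<close>

lemma prism_cobd:
  "prism \<alpha> \<beta> (cobd \<phi>) vs + cobd (prism \<alpha> \<beta> \<phi>) vs = \<phi> (map \<alpha> vs) + \<phi> (map \<beta> vs)"
proof (induction vs arbitrary: \<phi>)
  case (Cons v vs)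
  have IH: "prism \<alpha> \<beta> (cobd (\<lambda>ws. \<phi> (\<alpha> v # ws))) vs =
      cobd (prism \<alpha> \<beta> (\<lambda>ws. \<phi> (\<alpha> v # ws))) vs + (\<phi> (\<alpha> v # map \<alpha> vs) + \<phi> (\<alpha> v # map \<beta> vs))"
    using Cons[of "\<lambda>ws. \<phi> (\<alpha> v # ws)"]
    by (metis (no_types, lifting) add.commute bit_add_self_left)
  show ?case
    by (simp add: cobd_add prism_add IH cobd_map add.assoc add.commute add.left_commute)
qed simp

lemma prism_cong:
  assumes "\<And>us w ws. vs = us @ w # ws \<Longrightarrow>
    \<phi> (map \<alpha> us @ \<alpha> w # \<beta> w # map \<beta> ws) = \<psi> (map \<alpha> us @ \<alpha> w # \<beta> w # map \<beta> ws)"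
  shows "prism \<alpha> \<beta> \<phi> vs = prism \<alpha> \<beta> \<psi> vs"
  using assms
proof (induction vs arbitrary: \<phi> \<psi>)
  case (Cons v vs)
  have "prism \<alpha> \<beta> (\<lambda>ws. \<phi> (\<alpha> v # ws)) vs = prism \<alpha> \<beta> (\<lambda>ws. \<psi> (\<alpha> v # ws)) vs"
    using Cons.prems[of "v # _"] by (intro Cons.IH) simp
  with Cons.prems[of "[]"] show ?case
    by simp
qed simp

section \<open>Products of spheres and of hemispheres\<close>

type_synonym point = "nat \<Rightarrow> nat \<Rightarrow> real"

text \<open>
  A point is a tuple of \<open>r\<close> vectors, the \<open>i\<close>-th of which lies on the unit sphere of the
  \<open>\<ell>\<^sub>1\<close>-norm in dimension \<open>d i + 1\<close>. For this norm the upper hemisphere is star-shaped about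
  its pole, so the linear contraction \<open>slide\<close> onto the pole stays on the sphere.
\<close>

definition cell :: "nat \<Rightarrow> (nat \<Rightarrow> nat) \<Rightarrow> point set" where
  "cell r l = {x. (\<forall>i<r. (\<Sum>j\<le>l i. \<bar>x i j\<bar>) = 1 \<and> 0 \<le> x i (l i) \<and> (\<forall>j>l i. x i j = 0)) \<and>
     (\<forall>i\<ge>r. \<forall>j. x i j = 0)}"

definition spheres :: "nat \<Rightarrow> (nat \<Rightarrow> nat) \<Rightarrow> point set" where
  "spheres r d = {x. (\<forall>i<r. (\<Sum>j\<le>d i. \<bar>x i j\<bar>) = 1 \<and> (\<forall>j>d i. x i j = 0)) \<and>
     (\<forall>i\<ge>r. \<forall>j. x i j = 0)}"

definition flip :: "nat \<Rightarrow> point \<Rightarrow> point" where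
  "flip i x = x(i := \<lambda>j. - x i j)"

definition apex :: "nat \<Rightarrow> (nat \<Rightarrow> nat) \<Rightarrow> point" where
  "apex r l = (\<lambda>i j. if i < r \<and> j = l i then 1 else 0)"

definition slide :: "nat \<Rightarrow> (nat \<Rightarrow> nat) \<Rightarrow> real \<Rightarrow> point \<Rightarrow> point" where
  "slide r l t x = (\<lambda>i j. (1 - t) * x i j + t * apex r l i j)"

definition close :: "real \<Rightarrow> point set \<Rightarrow> bool" where
  "close \<delta> S \<longleftrightarrow> (\<forall>v\<in>S. \<forall>w\<in>S. \<forall>i j. \<bar>v i j - w i j\<bar> \<le> \<delta>)"

lemma flip_flip [simp]: "flip i (flip i x) = x"
  by (auto simp: flip_def)

lemma flip_commute: "flip i (flip j x) = flip j (flip i x)"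
  by (auto simp: flip_def)

lemma slide_0 [simp]: "slide r l 0 x = x"
  by (simp add: slide_def)

lemma slide_1 [simp]: "slide r l 1 x = apex r l"
  by (simp add: slide_def)

lemma abs_le_1_cell:
  assumes "x \<in> cell r l"
  shows "\<bar>x i j\<bar> \<le> 1"
proof (cases "i < r \<and> j \<le> l i")
  case True
  then have "\<bar>x i j\<bar> \<le> (\<Sum>j\<le>l i. \<bar>x i j\<bar>)"
    by (intro member_le_sum) auto
  then show ?thesis
    using assms True by (auto simp: cell_def)
next
  case False
  then show ?thesis
    using assms by (cases "i < r") (auto simp: cell_def not_le not_less)
qed

lemma apex_cell: "apex r l \<in> cell r l"
proof -
  have "(\<Sum>j\<le>l i. \<bar>apex r l i j\<bar>) = 1" if "i < r" for i
    using that by (simp add: apex_def if_distrib cong: if_cong)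
  then show ?thesis
    by (auto simp: cell_def apex_def)
qed

lemma slide_cell:
  assumes x: "x \<in> cell r l" and t: "0 \<le> t" "t \<le> 1"
  shows "slide r l t x \<in> cell r l"
proof -
  have "(\<Sum>j\<le>l i. \<bar>slide r l t x i j\<bar>) = 1" if i: "i < r" for i
  proof -
    have pos: "0 \<le> x i (l i)" and s: "(\<Sum>j\<le>l i. \<bar>x i j\<bar>) = 1"
      using x i by (auto simp: cell_def)
    have "\<bar>slide r l t x i j\<bar> = (1 - t) * \<bar>x i j\<bar> + t * (if j = l i then 1 else 0)" for j
      using t pos i by (auto simp: slide_def apex_def abs_mult)
    then have "(\<Sum>j\<le>l i. \<bar>slide r l t x i j\<bar>) =
        (1 - t) * (\<Sum>j\<le>l i. \<bar>x i j\<bar>) + t * (\<Sum>j\<le>l i. if j = l i then 1 else 0)"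
      by (simp add: sum.distrib flip: sum_distrib_left)
    then show ?thesis
      using s by simp
  qed
  moreover have "0 \<le> slide r l t x i (l i)" if "i < r" for i
    using x t that by (auto simp: cell_def slide_def apex_def)
  moreover have "slide r l t x i j = 0" if "i < r" "j > l i" for i j
    using x that by (auto simp: cell_def slide_def apex_def)
  moreover have "slide r l t x i j = 0" if "i \<ge> r" for i j
    using x that by (auto simp: cell_def slide_def apex_def)
  ultimately show ?thesis
    by (auto simp: cell_def)
qed

text \<open>The boundary sphere of the \<open>i\<close>-th hemisphere consists of the next smaller
  hemisphere and its image under \<open>flip i\<close>. Both lie in the larger cell because the
  coordinate \<open>l i\<close> vanishes on them.\<close>

lemma cell_face:
  assumes "x \<in> cell r (l(i := l i - 1))" "0 < l i" "i < r"
  shows "x \<in> cell r l" "flip i x \<in> cell r l"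
proof -
  have *: "(\<Sum>j\<le>l i. \<bar>x i j\<bar>) = (\<Sum>j\<le>l i - 1. \<bar>x i j\<bar>) + \<bar>x i (l i)\<bar>"
    using \<open>0 < l i\<close> by (cases "l i") auto
  have z: "x i j = 0" if "j > l i - 1" for j
    using assms that by (auto simp: cell_def)
  have s: "(\<Sum>j\<le>l i. \<bar>x i j\<bar>) = 1"
    using assms z[of "l i"] unfolding * by (auto simp: cell_def)
  have o: "(\<Sum>j\<le>l k. \<bar>x k j\<bar>) = 1 \<and> 0 \<le> x k (l k) \<and> (\<forall>j>l k. x k j = 0)"
    if "k < r" "k \<noteq> i" for k
    using assms(1) that by (auto simp: cell_def)
  have o': "x k j = 0" if "k \<ge> r" for k j
    using assms(1) that by (auto simp: cell_def)
  have "\<forall>k<r. (\<Sum>j\<le>l k. \<bar>x k j\<bar>) = 1 \<and> 0 \<le> x k (l k) \<and> 0 \<le> flip i x k (l k) \<and> (\<forall>j>l k. x k j = 0)"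
  proof (intro allI impI)
    fix k assume "k < r"
    then show "(\<Sum>j\<le>l k. \<bar>x k j\<bar>) = 1 \<and> 0 \<le> x k (l k) \<and> 0 \<le> flip i x k (l k) \<and> (\<forall>j>l k. x k j = 0)"
      using o[of k] s z \<open>0 < l i\<close> by (cases "k = i") (auto simp: flip_def)
  qed
  then show "x \<in> cell r l" "flip i x \<in> cell r l"
    using o' by (auto simp: cell_def flip_def)
qed

lemma cell_subset_spheres:
  assumes "\<And>i. i < r \<Longrightarrow> l i \<le> d i"
  shows "cell r l \<subseteq> spheres r d"
proof
  fix x assume x: "x \<in> cell r l"
  have "(\<Sum>j\<le>d i. \<bar>x i j\<bar>) = (\<Sum>j\<le>l i. \<bar>x i j\<bar>)" if "i < r" for i
    using x that assms[of i] by (intro sum.mono_neutral_right) (auto simp: cell_def)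
  then show "x \<in> spheres r d"
    using x assms by (fastforce simp: cell_def spheres_def)
qed

section \<open>Fillings, fundamental chains and Stokes' formula\<close>

context
  fixes r M :: nat
begin

text \<open>
  The cone over a cycle towards the pole, cut into \<open>M\<close> layers so that all simplices stay small.
\<close>

definition fill :: "(nat \<Rightarrow> nat) \<Rightarrow> (point list \<Rightarrow> bit) \<Rightarrow> point list \<Rightarrow> bit" where
  "fill l \<phi> vs =
     (\<Sum>j<M. prism (slide r l (real j / real M)) (slide r l (real (Suc j) / real M)) \<phi> vs) +
     \<phi> (apex r l # map (slide r l (real M / real M)) vs)"

lemma fill_add: "fill l (\<lambda>vs. \<phi> vs + \<psi> vs) vs = fill l \<phi> vs + fill l \<psi> vs"
  by (simp add: fill_def prism_add sum.distrib ac_simps)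

text \<open>The prisms telescope from the simplex to its image at the final parameter, and the cone
  with vertex \<open>apex r l\<close> fills that image. Writing this parameter as
  \<open>real M / real M\<close> makes the identity hold for \<open>M = 0\<close> too, where the
  quotient is 0.\<close>

lemma fill_cobd: "fill l (cobd \<phi>) vs = \<phi> vs + cobd (fill l \<phi>) vs"
proof -
  define H where "H = (\<lambda>j. slide r l (real j / real M))"
  have tele: "(\<Sum>j<n. \<phi> (map (H j) vs) + \<phi> (map (H (Suc j)) vs)) =
      \<phi> (map (H 0) vs) + \<phi> (map (H n) vs)" for n
    by (induction n) (simp_all add: add.assoc)
  have "map (H 0) vs = vs"
    by (rule map_idI) (simp add: H_def)
  have "fill l (cobd \<phi>) vs + cobd (fill l \<phi>) vs =
     (\<Sum>j<M. prism (H j) (H (Suc j)) (cobd \<phi>) vs + cobd (prism (H j) (H (Suc j)) \<phi>) vs) +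
     (cobd \<phi> (apex r l # map (H M) vs) + cobd (\<lambda>vs. \<phi> (apex r l # map (H M) vs)) vs)"
    unfolding fill_def[abs_def] H_def by (simp add: cobd_add cobd_sum sum.distrib ac_simps)
  also have "\<dots> = \<phi> vs"
    unfolding prism_cobd tele \<open>map (H 0) vs = vs\<close>
    by (simp add: cobd_map add.assoc)
  finally show ?thesis
    by (metis add.commute bit_add_self_left)
qed

text \<open>At a fixed parameter \<open>slide\<close> contracts distances by the factor
  \<open>1 - t\<close>. A change of the parameter by \<open>1 / M\<close> moves a point by at most
  \<open>2 / M\<close>, since all coordinates lie between -1 and 1.\<close>

lemma close_slide:
  assumes vs: "set vs \<subseteq> cell r l" "close \<delta> (set vs)" and t: "0 \<le> t" "t \<le> 1" "0 \<le> t'" "t' \<le> 1"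
    and d: "\<bar>t - t'\<bar> \<le> 1 / real M" and "v \<in> set vs" "w \<in> set vs"
  shows "\<bar>slide r l t v i j - slide r l t' w i j\<bar> \<le> \<delta> + 2 / real M"
proof -
  have \<delta>: "\<bar>v i j - w i j\<bar> \<le> \<delta>"
    using assms by (auto simp: close_def)
  have w: "\<bar>w i j\<bar> \<le> 1" "\<bar>apex r l i j\<bar> \<le> 1"
    using assms abs_le_1_cell apex_cell by blast+
  have "slide r l t v i j - slide r l t' w i j =
      (1 - t) * (v i j - w i j) + (t' - t) * (w i j - apex r l i j)"
    by (simp add: slide_def algebra_simps)
  also have "\<bar>\<dots>\<bar> \<le> (1 - t) * \<bar>v i j - w i j\<bar> + \<bar>t' - t\<bar> * \<bar>w i j - apex r l i j\<bar>"
    using t by (intro order_trans[OF abs_triangle_ineq]) (auto simp: abs_mult)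
  also have "\<dots> \<le> 1 * \<bar>v i j - w i j\<bar> + (1 / real M) * 2"
    using w d t by (intro add_mono mult_mono) auto
  finally show ?thesis
    using \<delta> by simp
qed

lemma close_slide':
  assumes "set vs \<subseteq> cell r l" "close \<delta> (set vs)" "j < M" "A \<subseteq> set vs" "B \<subseteq> set vs"
  shows "close (\<delta> + 2 / real M)
    (slide r l (real j / real M) ` A \<union> slide r l (real (Suc j) / real M) ` B)"
proof -
  have d: "\<bar>real j / real M - real (Suc j) / real M\<bar> = 1 / real M"
    "\<bar>real (Suc j) / real M - real j / real M\<bar> = 1 / real M"
    using \<open>j < M\<close> by (auto simp: diff_divide_distrib[symmetric])
  show ?thesis
    unfolding close_def using assms(3-5)
    by (auto simp del: of_nat_Suc intro!: close_slide[OF assms(1,2)] simp: d)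
qed

lemma fill_cong:
  assumes vs: "set vs \<subseteq> cell r l" "close \<delta> (set vs)" and "0 \<le> \<delta>" "0 < M"
    and eq: "\<And>ws. length ws = Suc (length vs) \<Longrightarrow> set ws \<subseteq> cell r l \<Longrightarrow>
      close (\<delta> + 2 / real M) (set ws) \<Longrightarrow> \<phi> ws = \<psi> ws"
  shows "fill l \<phi> vs = fill l \<psi> vs"
proof -
  have "prism (slide r l (real j / real M)) (slide r l (real (Suc j) / real M)) \<phi> vs =
      prism (slide r l (real j / real M)) (slide r l (real (Suc j) / real M)) \<psi> vs"
    if j: "j < M" for j
  proof (rule prism_cong)
    fix us w ws
    assume "vs = us @ w # ws"
    then have sub: "insert w (set us) \<subseteq> set vs" "insert w (set ws) \<subseteq> set vs"
        and len: "length vs = length us + Suc (length ws)"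
      by auto
    let ?H = "\<lambda>j. slide r l (real j / real M)"
    let ?l = "map (?H j) us @ ?H j w # ?H (Suc j) w # map (?H (Suc j)) ws"
    have set: "set ?l = ?H j ` insert w (set us) \<union> ?H (Suc j) ` insert w (set ws)"
      by auto
    show "\<phi> ?l = \<psi> ?l"
    proof (rule eq)
      show "length ?l = Suc (length vs)"
        using len by simp
      show "set ?l \<subseteq> cell r l"
        unfolding set using sub vs(1) j by (auto simp del: of_nat_Suc intro!: slide_cell)
      show "close (\<delta> + 2 / real M) (set ?l)"
        unfolding set by (rule close_slide'[OF vs j sub])
    qed
  qed
  moreover have "\<phi> (apex r l # map (slide r l (real M / real M)) vs) =
      \<psi> (apex r l # map (slide r l (real M / real M)) vs)"
    using \<open>0 < M\<close> \<open>0 \<le> \<delta>\<close> apex_cell[of r l] by (intro eq) (auto simp: close_def)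
  ultimately show ?thesis
    by (simp add: fill_def)
qed

text \<open>Evaluation on a fundamental chain of \<open>cell r l\<close>, whose dimension is
  \<open>K\<close>: the filling of the chains of its boundary faces, which are a smaller cell and
  its mirror image for each factor of positive dimension.\<close>

primrec chain :: "nat \<Rightarrow> (nat \<Rightarrow> nat) \<Rightarrow> (point list \<Rightarrow> bit) \<Rightarrow> bit" where
  "chain 0 l \<phi> = \<phi> [apex r l]"
| "chain (Suc K) l \<phi> = (\<Sum>i\<in>{i. i < r \<and> 0 < l i}.
     chain K (l(i := l i - 1)) (fill l \<phi>) +
     chain K (l(i := l i - 1)) (\<lambda>vs. fill l \<phi> (map (flip i) vs)))"

lemma chain_add: "chain K l (\<lambda>vs. \<phi> vs + \<psi> vs) = chain K l \<phi> + chain K l \<psi>"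
proof (induction K arbitrary: l \<phi> \<psi>)
  case (Suc K)
  have "fill l (\<lambda>vs. \<phi> vs + \<psi> vs) = (\<lambda>vs. fill l \<phi> vs + fill l \<psi> vs)"
    by (rule ext) (rule fill_add)
  then have "chain (Suc K) l (\<lambda>vs. \<phi> vs + \<psi> vs) = (\<Sum>i\<in>{i. i < r \<and> 0 < l i}.
     (chain K (l(i := l i - 1)) (fill l \<phi>) + chain K (l(i := l i - 1)) (fill l \<psi>)) +
     (chain K (l(i := l i - 1)) (\<lambda>vs. fill l \<phi> (map (flip i) vs)) +
      chain K (l(i := l i - 1)) (\<lambda>vs. fill l \<psi> (map (flip i) vs))))"
    by (simp only: chain.simps Suc.IH)
  also have "\<dots> = chain (Suc K) l \<phi> + chain (Suc K) l \<psi>"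
    unfolding chain.simps sum.distrib by (simp only: ac_simps)
  finally show ?case .
qed simp

lemma chain_zero [simp]: "chain K l (\<lambda>vs. 0) = 0"
  using chain_add[of K l "\<lambda>_. 0" "\<lambda>_. 0"] by simp

lemma chain_mult: "chain K l (\<lambda>vs. c * \<phi> vs) = c * chain K l \<phi>"
  by (cases c) simp_all

lemma sum_face:
  assumes "sum l {..<r} = Suc K" "i < r" "0 < l i"
  shows "sum (l(i := l i - 1)) {..<r} = (K::nat)"
proof -
  have "sum l {..<r} = l i + sum l ({..<r} - {i})"
    "sum (l(i := l i - 1)) {..<r} = (l i - 1) + sum (l(i := l i - 1)) ({..<r} - {i})"
    using assms(2) by (auto simp: sum.remove)
  moreover have "sum (l(i := l i - 1)) ({..<r} - {i}) = sum l ({..<r} - {i})"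
    by (intro sum.cong) auto
  ultimately show ?thesis
    using assms by simp
qed

text \<open>Stokes' formula for cells. By \<open>fill_cobd\<close> the right-hand side appears
  together with the boundary evaluated on \<open>cobd (fill l \<phi>)\<close>; by induction the
  latter is a sum over faces of faces, each of which occurs twice.\<close>

lemma chain_cobd:
  assumes "sum l {..<r} = Suc K"
  shows "chain (Suc K) l (cobd \<phi>) = (\<Sum>i\<in>{i. i < r \<and> 0 < l i}.
     chain K (l(i := l i - 1)) \<phi> + chain K (l(i := l i - 1)) (\<lambda>vs. \<phi> (map (flip i) vs)))"
  using assms
proof (induction K arbitrary: l \<phi>)
  case 0
  \<comment> \<open>On a single point the augmented coboundary of \<open>fill l \<phi>\<close> is
    its value at the empty list, which the two points of a face contribute twice.\<close>
  show ?case
    unfolding chain.simps fill_cobd by (intro sum.cong) (simp_all add: ac_simps)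
next
  case (Suc K)
  define F :: "(nat \<Rightarrow> nat) \<Rightarrow> nat set" where "F = (\<lambda>l. {i. i < r \<and> 0 < l i})"
  define D :: "(nat \<Rightarrow> nat) \<Rightarrow> nat \<Rightarrow> nat \<Rightarrow> nat" where "D = (\<lambda>l i. l(i := l i - 1))"
  define b where "b = (\<lambda>\<psi>. \<Sum>i\<in>F l.
     chain (Suc K) (D l i) \<psi> + chain (Suc K) (D l i) (\<lambda>vs. \<psi> (map (flip i) vs)))"
  have b_add: "b (\<lambda>vs. \<phi> vs + \<psi> vs) = b \<phi> + b \<psi>" for \<phi> \<psi>
    unfolding b_def by (simp only: chain_add sum.distrib) (simp add: ac_simps)
  have "b (cobd \<psi>) = 0" for \<psi>
  proof -
    \<comment> \<open>The contribution of lowering first factor \<open>i\<close> and then factor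
      \<open>j\<close>, with all four choices of flips.\<close>
    define a where "a = (\<lambda>i j. if i \<in> F l \<and> j \<in> F (D l i) then
      chain K (D (D l i) j) \<psi> + chain K (D (D l i) j) (\<lambda>vs. \<psi> (map (flip j) vs)) +
      (chain K (D (D l i) j) (\<lambda>vs. \<psi> (map (flip i) vs)) +
       chain K (D (D l i) j) (\<lambda>vs. \<psi> (map (flip i) (map (flip j) vs)))) else 0)"
    have IH: "chain (Suc K) (D l i) (cobd \<psi>) + chain (Suc K) (D l i) (\<lambda>vs. cobd \<psi> (map (flip i) vs))
        = (\<Sum>j<r. a i j)" if i: "i \<in> F l" for i
    proof -
      have s: "sum (D l i) {..<r} = Suc K"
        unfolding D_def using sum_face[OF Suc.prems, of i] i by (auto simp: F_def)
      have "(\<Sum>j<r. a i j) = (\<Sum>j\<in>F (D l i). a i j)"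
        by (intro sum.mono_neutral_right) (auto simp: F_def a_def)
      also have "\<dots> = (\<Sum>j\<in>F (D l i).
        chain K (D (D l i) j) \<psi> + chain K (D (D l i) j) (\<lambda>vs. \<psi> (map (flip j) vs))) +
        (\<Sum>j\<in>F (D l i). chain K (D (D l i) j) (\<lambda>vs. \<psi> (map (flip i) vs)) +
         chain K (D (D l i) j) (\<lambda>vs. \<psi> (map (flip i) (map (flip j) vs))))"
        using i by (simp add: a_def sum.distrib)
      also have "\<dots> = chain (Suc K) (D l i) (cobd \<psi>) +
          chain (Suc K) (D l i) (cobd (\<lambda>vs. \<psi> (map (flip i) vs)))"
        using Suc.IH[OF s, of \<psi>] Suc.IH[OF s, of "\<lambda>vs. \<psi> (map (flip i) vs)"]
        by (simp only: F_def D_def)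
      finally show ?thesis
        by (simp only: cobd_map)
    qed
    have "b (cobd \<psi>) = (\<Sum>i\<in>F l. \<Sum>j<r. a i j)"
      unfolding b_def using IH by (intro sum.cong) auto
    also have "\<dots> = (\<Sum>i<r. \<Sum>j<r. a i j)"
      by (intro sum.mono_neutral_left) (auto simp: F_def a_def)
    also have "\<dots> = 0"
    proof (rule bit_sum_symmetric)
      fix i j
      show "a i j = a j i"
      proof (cases "i = j")
        case False
        then have "D (D l i) j = D (D l j) i" "i \<in> F l \<and> j \<in> F (D l i) \<longleftrightarrow> j \<in> F l \<and> i \<in> F (D l j)"
          by (auto simp: D_def F_def fun_eq_iff)
        moreover have "(\<lambda>vs. \<psi> (map (flip i) (map (flip j) vs))) =
            (\<lambda>vs. \<psi> (map (flip j) (map (flip i) vs)))"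
          by (simp add: comp_def flip_commute[of i j])
        ultimately show ?thesis
          unfolding a_def by (simp add: ac_simps)
      qed simp
      \<comment> \<open>Two flips in the same factor compose to the identity, so the four terms
        cancel in pairs.\<close>
      show "a i i = 0"
        by (simp add: a_def comp_def ac_simps)
    qed simp
    finally show ?thesis .
  qed
  moreover have "chain (Suc (Suc K)) l (cobd \<phi>) = b (\<lambda>vs. \<phi> vs + cobd (fill l \<phi>) vs)"
    unfolding b_def F_def D_def chain.simps(2)[of "Suc K"] fill_cobd[abs_def] ..
  ultimately have "chain (Suc (Suc K)) l (cobd \<phi>) = b \<phi>"
    by (simp only: b_add add_0_right)
  then show ?case
    unfolding b_def F_def D_def .
qed

lemma close_flip: "close \<delta> (flip i ` S) \<longleftrightarrow> close \<delta> S"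
proof -
  have "\<bar>flip i v k j - flip i w k j\<bar> = \<bar>v k j - w k j\<bar>" for v w k j
    by (auto simp: flip_def)
  then show ?thesis
    by (auto simp: close_def)
qed

text \<open>Each of the \<open>K\<close> fillings enlarges the diameter of simplices by at most
  \<open>2 / M\<close>. A chain therefore only sees cochains on simplices that shrink as
  \<open>M\<close> grows.\<close>

lemma chain_cong:
  assumes "0 < M" "sum l {..<r} = K"
    and "\<And>vs. length vs = Suc K \<Longrightarrow> set vs \<subseteq> cell r l \<Longrightarrow> close (2 * real K / real M) (set vs) \<Longrightarrow>
      \<phi> vs = \<psi> vs"
  shows "chain K l \<phi> = chain K l \<psi>"
  using assms(2,3)
proof (induction K arbitrary: l \<phi> \<psi>)
  case 0
  then show ?case
    using apex_cell[of r l] by (auto simp: close_def)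
next
  case (Suc K)
  have step: "2 * real K / real M + 2 / real M = 2 * real (Suc K) / real M"
    by (simp add: add_divide_distrib algebra_simps)
  have fill: "fill l \<phi> vs = fill l \<psi> vs"
    if "length vs = Suc K" "set vs \<subseteq> cell r l" "close (2 * real K / real M) (set vs)" for vs
    using that \<open>0 < M\<close> Suc.prems(2) unfolding step[symmetric]
    by (intro fill_cong[where \<delta> = "2 * real K / real M"]) auto
  have "chain K (l(i := l i - 1)) (fill l \<phi>) = chain K (l(i := l i - 1)) (fill l \<psi>) \<and>
    chain K (l(i := l i - 1)) (\<lambda>vs. fill l \<phi> (map (flip i) vs)) =
    chain K (l(i := l i - 1)) (\<lambda>vs. fill l \<psi> (map (flip i) vs))" if i: "i < r" "0 < l i" for i
  proof -
    define l' where "l' = l(i := l i - 1)"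
    have s: "sum l' {..<r} = K"
      unfolding l'_def by (rule sum_face[OF Suc.prems(1) i])
    have face: "x \<in> cell r l" "flip i x \<in> cell r l" if "x \<in> cell r l'" for x
      using cell_face[of x r l i] that i by (auto simp: l'_def)
    have "chain K l' (fill l \<phi>) = chain K l' (fill l \<psi>)"
      by (intro Suc.IH s fill) (auto intro: face)
    moreover have "chain K l' (\<lambda>vs. fill l \<phi> (map (flip i) vs)) =
        chain K l' (\<lambda>vs. fill l \<psi> (map (flip i) vs))"
      by (intro Suc.IH s fill) (auto intro: face simp: close_flip)
    ultimately show ?thesis
      unfolding l'_def by blast
  qed
  then show ?case
    unfolding chain.simps by (intro sum.cong) auto
qed

end

section \<open>Cup products of coboundaries of 0-cochains\<close>

text \<open>The product of the coboundaries of the listed 0-cochains, written as the coboundary of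
  \<open>s\<close> times the remaining product so that Stokes' formula applies directly.
  \<open>cup []\<close> is the unit cochain in degree 0.\<close>

primrec cup :: "('p \<Rightarrow> bit) list \<Rightarrow> 'p list \<Rightarrow> bit" where
  "cup [] = (\<lambda>vs. of_bool (length vs = 1))"
| "cup (s # ss) = cobd (\<lambda>vs. s (hd vs) * cup ss vs)"

lemma cobd_cup: "cobd (cup ss) vs = 0"
proof (cases ss)
  case Nil
  consider "vs = []" | v where "vs = [v]" | v w where "vs = [v, w]" | u v w ws where "vs = u # v # w # ws"
    by (metis neq_Nil_conv)
  then show ?thesis
    by cases (simp_all add: Nil)
qed (simp add: cobd_cobd)

text \<open>Since \<open>cup ss\<close> is closed, the Leibniz rule leaves only the coboundary of
  \<open>s\<close> on the first edge times \<open>cup ss\<close> on the remaining face.\<close>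

lemma cup_Cons: "cup (s # ss) (v # vs) = (s (hd vs) + s v) * cup ss vs"
proof -
  have "cup ss vs + cobd (\<lambda>ws. cup ss (v # ws)) vs = 0"
    using cobd_cup[of ss "v # vs"] by simp
  then have "cobd (\<lambda>ws. cup ss (v # ws)) vs = cup ss vs"
    by (metis add.right_neutral bit_add_self_left)
  then show ?thesis
    by (simp add: cobd_mult algebra_simps)
qed

lemma cup_Nil [simp]: "cup ss [] = 0"
  by (cases ss) auto

text \<open>
  The coefficient of \<open>\<Prod>i<r. a\<^sub>i ^ l i\<close> in \<open>\<Prod>j<K. \<Sum>i\<in>\<tau> j. a\<^sub>i\<close>, provided that
  \<open>\<Sum>i<r. l i = K\<close>.
\<close>

primrec coef :: "(nat \<Rightarrow> nat set) \<Rightarrow> nat \<Rightarrow> nat \<Rightarrow> (nat \<Rightarrow> nat) \<Rightarrow> nat" where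
  "coef \<tau> r 0 l = 1"
| "coef \<tau> r (Suc K) l = (\<Sum>i | i < r \<and> 0 < l i \<and> i \<in> \<tau> K. coef \<tau> r K (l(i := l i - 1)))"

text \<open>By \<open>cup_Cons\<close> only differences of values of each \<open>s\<close> enter,
  and constants cancel in them.\<close>

lemma cup_flip:
  assumes "\<And>s. s \<in> set ss \<Longrightarrow> \<exists>c. \<forall>x\<in>S. s (g x) = s x + c" and "set vs \<subseteq> S"
  shows "cup ss (map g vs) = cup ss vs"
  using assms
proof (induction ss arbitrary: vs)
  case (Cons s ss)
  show ?case
  proof (cases vs)
    case vs: (Cons v ws)
    show ?thesis
    proof (cases ws)
      case ws: (Cons w us)
      obtain c where "s (g v) = s v + c" "s (g w) = s w + c"
        using Cons.prems(1)[of s] Cons.prems(2) vs ws by auto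
      then have "s (g w) + s (g v) = s w + s v"
        by (simp add: ac_simps)
      moreover have "cup ss (map g ws) = cup ss ws"
        using Cons vs by auto
      ultimately show ?thesis
        unfolding vs list.map cup_Cons using ws by simp
    qed (simp add: vs cup_Cons del: cup.simps)
  qed simp
qed simp

text \<open>Stokes' formula removes the outermost coboundary, that of \<open>s K\<close>. On the two
  faces of factor \<open>i\<close> the values of \<open>s K\<close> differ by the constant
  \<open>of_bool (i \<in> \<tau> K)\<close>, while the remaining product is invariant under the
  flip. What survives is that constant times the evaluation on the smaller cell, which is the
  recursion of \<open>coef\<close>.\<close>

lemma chain_cup:
  assumes "0 < M" "sum l {..<r} = K" "\<And>i. i < r \<Longrightarrow> l i \<le> d i"
    and eq: "\<And>i j x. i < r \<Longrightarrow> j < K \<Longrightarrow> x \<in> spheres r d \<Longrightarrow>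
      s j (flip i x) = s j x + of_bool (i \<in> \<tau> j)"
  shows "chain r M K l (cup (map s (rev [0..<K]))) = of_nat (coef \<tau> r K l)"
  using assms(2-)
proof (induction K arbitrary: l)
  case 0
  show ?case
    by simp
next
  case (Suc K)
  define C where "C = cup (map s (rev [0..<K]))"
  define f where "f = (\<lambda>i. l(i := l i - 1))"
  have summand: "chain r M K (f i) (\<lambda>vs. s K (hd vs) * C vs) +
      chain r M K (f i) (\<lambda>vs. s K (hd (map (flip i) vs)) * C (map (flip i) vs)) =
      of_bool (i \<in> \<tau> K) * of_nat (coef \<tau> r K (f i))" if i: "i < r" "0 < l i" for i
  proof -
    have sm: "sum (f i) {..<r} = K"
      unfolding f_def by (rule sum_face[OF Suc.prems(1) i])
    have le: "f i k \<le> d k" if "k < r" for k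
      using Suc.prems(2)[OF that] by (auto simp: f_def)
    have "s K (hd (map (flip i) vs)) * C (map (flip i) vs) =
        s K (hd vs) * C vs + of_bool (i \<in> \<tau> K) * C vs"
      if vs: "length vs = Suc K" "set vs \<subseteq> cell r (f i)" for vs
    proof -
      have sub: "set vs \<subseteq> spheres r d"
        using vs(2) cell_subset_spheres[of r "f i" d] le by blast
      have "C (map (flip i) vs) = C vs"
        unfolding C_def
      proof (rule cup_flip[OF _ sub])
        fix t
        assume "t \<in> set (map s (rev [0..<K]))"
        then obtain j where "t = s j" "j < K" by auto
        then show "\<exists>c. \<forall>x\<in>spheres r d. t (flip i x) = t x + c"
          using Suc.prems(3)[OF i(1), of j] by (intro exI[of _ "of_bool (i \<in> \<tau> j)"]) simp
      qed
      moreover have "hd (map (flip i) vs) = flip i (hd vs)" "hd vs \<in> spheres r d"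
        using vs sub by (cases vs; auto)+
      ultimately show ?thesis
        using Suc.prems(3)[OF i(1), of K "hd vs"] by (simp add: distrib_right)
    qed
    then have "chain r M K (f i) (\<lambda>vs. s K (hd (map (flip i) vs)) * C (map (flip i) vs)) =
      chain r M K (f i) (\<lambda>vs. s K (hd vs) * C vs + of_bool (i \<in> \<tau> K) * C vs)"
      by (intro chain_cong[OF \<open>0 < M\<close> sm]) auto
    moreover have "chain r M K (f i) C = of_nat (coef \<tau> r K (f i))"
      unfolding C_def using Suc.prems le by (intro Suc.IH sm) auto
    ultimately show ?thesis
      by (simp add: chain_add chain_mult)
  qed
  have "chain r M (Suc K) l (cup (map s (rev [0..<Suc K]))) =
      chain r M (Suc K) l (cobd (\<lambda>vs. s K (hd vs) * C vs))"
    by (simp add: C_def)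
  also have "\<dots> = (\<Sum>i | i < r \<and> 0 < l i. of_bool (i \<in> \<tau> K) * of_nat (coef \<tau> r K (f i)))"
    unfolding chain_cobd[OF Suc.prems(1)] using summand unfolding f_def
    by (intro sum.cong) auto
  also have "\<dots> = (\<Sum>i | i < r \<and> 0 < l i \<and> i \<in> \<tau> K. of_nat (coef \<tau> r K (f i)))"
    by (intro sum.mono_neutral_cong_right) auto
  finally show ?case
    by (simp add: f_def)
qed

text \<open>The value is a product of differences along edges of the simplex, one for each
  \<open>s j\<close>, so none of them vanishes.\<close>

lemma cup_sign_change:
  assumes "length vs = Suc K" "cup (map s (rev [0..<K])) vs \<noteq> 0" "j < K"
  shows "\<exists>v\<in>set vs. \<exists>w\<in>set vs. s j v \<noteq> s j w"
  using assms
proof (induction K arbitrary: vs)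
  case 0
  from \<open>j < 0\<close> show ?case
    by simp
next
  case (Suc K)
  then obtain v ws where vs: "vs = v # ws" and ws: "length ws = Suc K"
    by (auto simp: length_Suc_conv)
  have "s K (hd ws) + s K v \<noteq> 0" and c: "cup (map s (rev [0..<K])) ws \<noteq> 0"
    using Suc.prems(2) unfolding vs by (auto simp: cup_Cons simp del: cup.simps(2))
  then have n: "s K (hd ws) \<noteq> s K v"
    by auto
  show ?case
  proof (cases "j = K")
    case True
    have "hd ws \<in> set ws"
      using ws by (cases ws) auto
    then show ?thesis
      using n True unfolding vs by auto
  next
    case False
    then have "\<exists>v\<in>set ws. \<exists>w\<in>set ws. s j v \<noteq> s j w"
      using Suc.prems(3) by (intro Suc.IH[OF ws c]) simp
    then show ?thesis
      unfolding vs by (meson list.set_intros(2))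
  qed
qed

section \<open>Compactness and passage to the limit\<close>

lemma compact_componentwise:
  fixes B :: "'a \<Rightarrow> ('b::topological_space) set"
  assumes "\<And>i. compact (B i)"
  shows "compact {x. \<forall>i. x i \<in> B i}"
proof -
  have "compactin (product_topology (\<lambda>_. euclidean) UNIV) (PiE UNIV B)"
    using assms by (simp add: compactin_PiE)
  moreover have "PiE UNIV B = {x. \<forall>i. x i \<in> B i}"
    by (auto simp: PiE_def)
  ultimately show ?thesis
    by (simp add: euclidean_product_topology)
qed

lemma continuous_on_double_coordinate [continuous_intros]:
  "continuous_on S (\<lambda>x::point. x i j)"
  using continuous_on_product_then_coordinatewise[OF
    continuous_on_product_then_coordinatewise[OF continuous_on_id]] .

lemma compact_spheres: "compact (spheres r d)"
proof -
  let ?B = "{x::point. \<forall>i. x i \<in> {y. \<forall>j. y j \<in> {-1..1}}}"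
  have "compact ?B"
    by (intro compact_componentwise compact_Icc)
  moreover have "closed (spheres r d)"
    unfolding spheres_def
    by (intro closed_Collect_conj closed_Collect_all closed_Collect_imp closed_Collect_eq
        continuous_intros) auto
  moreover have "spheres r d \<subseteq> ?B"
  proof safe
    fix x i j assume x: "x \<in> spheres r d"
    have "\<bar>x i j\<bar> \<le> 1"
    proof (cases "i < r \<and> j \<le> d i")
      case True
      then have "\<bar>x i j\<bar> \<le> (\<Sum>j\<le>d i. \<bar>x i j\<bar>)"
        by (intro member_le_sum) auto
      then show ?thesis
        using x True by (auto simp: spheres_def)
    next
      case False
      then show ?thesis
        using x by (cases "i < r") (auto simp: spheres_def not_le not_less)
    qed
    then show "x i j \<in> {-1..1}"
      by auto
  qed
  then have "spheres r d = ?B \<inter> spheres r d"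
    by blast
  ultimately show ?thesis
    using compact_Int_closed[of ?B "spheres r d"] by simp
qed

lemma tendsto_fun_iff:
  fixes f :: "'c \<Rightarrow> 'a \<Rightarrow> 'b::topological_space"
  shows "(f \<longlongrightarrow> l) F \<longleftrightarrow> (\<forall>i. ((\<lambda>x. f x i) \<longlongrightarrow> l i) F)"
  using limitin_componentwise[of "\<lambda>_. euclidean" UNIV f l F] by (simp add: euclidean_product_topology)

lemma of_nat_bit_eq_0_iff: "of_nat n = (0::bit) \<longleftrightarrow> even n"
proof (induction n)
  case (Suc n)
  have "(1 + x = 0) = (x \<noteq> 0)" for x :: bit
    by (cases x) auto
  with Suc show ?case
    unfolding of_nat_Suc even_Suc by blast
qed simp

text \<open>For every subdivision the odd coefficient yields a small simplex on which the cup
  product of the sign cochains is nonzero, hence on which every \<open>f j\<close> takes two values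
  with nonpositive product. A limit point of such simplices is a common zero.\<close>

theorem product_borsuk_ulam:
  fixes f :: "nat \<Rightarrow> point \<Rightarrow> real"
  assumes K: "K = sum d {..<r}"
    and cont: "\<And>j. j < K \<Longrightarrow> continuous_on (spheres r d) (f j)"
    and equi: "\<And>i j x. i < r \<Longrightarrow> j < K \<Longrightarrow> x \<in> spheres r d \<Longrightarrow>
      f j (flip i x) = (if i \<in> \<tau> j then - f j x else f j x)"
    and \<tau>: "\<And>j. j < K \<Longrightarrow> \<tau> j \<subseteq> {..<r}"
    and "odd (coef \<tau> r K d)"
  shows "\<exists>x\<in>spheres r d. \<forall>j<K. f j x = 0"
proof -
  \<comment> \<open>Where \<open>f j\<close> vanishes, its sign is replaced by a product of signs of leading coordinates, which
    has the right equivariance.\<close>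
  define lead :: "nat \<Rightarrow> point \<Rightarrow> bit"
    where "lead = (\<lambda>i x. of_bool (x i (LEAST k. x i k \<noteq> 0) < 0))"
  define s where "s = (\<lambda>j x. if f j x = 0 then \<Sum>i\<in>\<tau> j. lead i x else of_bool (f j x < 0))"
  have lead: "lead k (flip i x) = lead k x + of_bool (i = k)"
    if "k < r" "x \<in> spheres r d" for i k x
  proof -
    have "\<exists>j. x k j \<noteq> 0"
      using that by (auto simp: spheres_def) (metis abs_zero sum.neutral zero_neq_one)
    then have "x k (LEAST j. x k j \<noteq> 0) \<noteq> 0"
      by (rule LeastI_ex)
    then show ?thesis
      by (auto simp: lead_def flip_def)
  qed
  have s: "s j (flip i x) = s j x + of_bool (i \<in> \<tau> j)"
    if "i < r" "j < K" "x \<in> spheres r d" for i j x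
  proof (cases "f j x = 0")
    case True
    have "finite (\<tau> j)"
      using \<tau>[OF that(2)] finite_subset by blast
    have "(\<Sum>k\<in>\<tau> j. lead k (flip i x)) = (\<Sum>k\<in>\<tau> j. lead k x + of_bool (i = k))"
      using \<tau>[OF that(2)] that lead by (intro sum.cong) auto
    also have "\<dots> = (\<Sum>k\<in>\<tau> j. lead k x) + of_bool (i \<in> \<tau> j)"
      using \<open>finite (\<tau> j)\<close> by (simp add: sum.distrib of_bool_def)
    finally show ?thesis
      using True equi[OF that] by (simp add: s_def)
  next
    case False
    then show ?thesis
      using equi[OF that] by (auto simp: s_def)
  qed
  have "\<exists>vs. length vs = Suc K \<and> set vs \<subseteq> spheres r d \<and> close (2 * real K / real (Suc n)) (set vs) \<and>
      (\<forall>j<K. \<exists>v\<in>set vs. \<exists>w\<in>set vs. f j v * f j w \<le> 0)" for n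
  proof -
    have "chain r (Suc n) K d (cup (map s (rev [0..<K]))) = of_nat (coef \<tau> r K d)"
      by (rule chain_cup[OF zero_less_Suc K[symmetric] order_refl s])
    then have ne: "chain r (Suc n) K d (cup (map s (rev [0..<K]))) \<noteq> chain r (Suc n) K d (\<lambda>_. 0)"
      using \<open>odd _\<close> by (simp add: of_nat_bit_eq_0_iff)
    have "\<exists>vs. length vs = Suc K \<and> set vs \<subseteq> cell r d \<and>
        close (2 * real K / real (Suc n)) (set vs) \<and> cup (map s (rev [0..<K])) vs \<noteq> 0"
    proof (rule ccontr)
      assume "\<not> ?thesis"
      then have "chain r (Suc n) K d (cup (map s (rev [0..<K]))) = chain r (Suc n) K d (\<lambda>_. 0)"
        by (intro chain_cong zero_less_Suc K[symmetric]) blast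
      with ne show False ..
    qed
    then obtain vs where vs: "length vs = Suc K" "set vs \<subseteq> cell r d"
        "close (2 * real K / real (Suc n)) (set vs)" "cup (map s (rev [0..<K])) vs \<noteq> 0"
      by blast
    \<comment> \<open>If neither value is zero the signs differ; otherwise the product is zero,
      whatever the substitute sign.\<close>
    have "f j v * f j w \<le> 0" if "s j v \<noteq> s j w" for j v w
      using that by (auto simp: s_def mult_le_0_iff split: if_splits)
    then show ?thesis
      using vs cup_sign_change[OF vs(1,4)] cell_subset_spheres[of r d d]
      by (intro exI[of _ vs]) (meson order_refl subset_trans)
  qed
  then obtain V where len: "\<And>n. length (V n) = Suc K" and sub: "\<And>n. set (V n) \<subseteq> spheres r d"
      and cl: "\<And>n. close (2 * real K / real (Suc n)) (set (V n))"
      and sign: "\<And>n j. j < K \<Longrightarrow> \<exists>v\<in>set (V n). \<exists>w\<in>set (V n). f j v * f j w \<le> 0"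
    by metis
  have hd: "hd (V n) \<in> set (V n)" for n
    using len[of n] by (cases "V n") auto
  then have "hd (V n) \<in> spheres r d" for n
    using sub by blast
  then obtain x \<rho> where x: "x \<in> spheres r d" and \<rho>: "strict_mono \<rho>"
      and lim: "((\<lambda>n. hd (V n)) \<circ> \<rho>) \<longlonglongrightarrow> x"
    using compact_spheres[of r d] by (meson compact_imp_seq_compact seq_compactE)
  \<comment> \<open>The diameters tend to 0, so every choice of vertices converges to the limit of
    the first vertices.\<close>
  have conv: "(\<lambda>n. v n) \<longlonglongrightarrow> x" if v: "\<And>n. v n \<in> set (V (\<rho> n))" for v
  proof -
    have "(\<lambda>n. v n i j) \<longlonglongrightarrow> x i j" for i j
    proof -
      have "(\<lambda>n. hd (V (\<rho> n)) i j) \<longlonglongrightarrow> x i j"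
        using lim by (simp add: o_def tendsto_fun_iff)
      moreover have "(\<lambda>n. v n i j - hd (V (\<rho> n)) i j) \<longlonglongrightarrow> 0"
      proof (rule Lim_null_comparison)
        show "\<forall>\<^sub>F n in sequentially. norm (v n i j - hd (V (\<rho> n)) i j) \<le> 2 * real K / real (Suc (\<rho> n))"
          using cl v hd by (intro always_eventually allI) (auto simp: close_def simp del: of_nat_Suc)
        have "(\<lambda>n. 2 * real K / real (Suc n)) \<longlonglongrightarrow> 0"
          using LIMSEQ_Suc[OF lim_const_over_n] by simp
        then show "(\<lambda>n. 2 * real K / real (Suc (\<rho> n))) \<longlonglongrightarrow> 0"
          using LIMSEQ_subseq_LIMSEQ[OF _ \<rho>] by (simp add: o_def)
      qed
      ultimately show ?thesis
        using tendsto_add by fastforce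
    qed
    then show ?thesis
      by (simp add: tendsto_fun_iff)
  qed
  have "f j x = 0" if j: "j < K" for j
  proof -
    have "\<exists>v w. v \<in> set (V (\<rho> n)) \<and> w \<in> set (V (\<rho> n)) \<and> f j v * f j w \<le> 0" for n
      using sign[OF j] by blast
    then obtain v w where vw: "\<And>n. v n \<in> set (V (\<rho> n))" "\<And>n. w n \<in> set (V (\<rho> n))"
        "\<And>n. f j (v n) * f j (w n) \<le> 0"
      by metis
    have "v n \<in> spheres r d" "w n \<in> spheres r d" for n
      using vw sub by blast+
    with vw have "(\<lambda>n. f j (v n)) \<longlonglongrightarrow> f j x" "(\<lambda>n. f j (w n)) \<longlonglongrightarrow> f j x"
      by (intro continuous_on_tendsto_compose[OF cont[OF j]] conv x always_eventually allI; blast)+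
    then have "(\<lambda>n. f j (v n) * f j (w n)) \<longlonglongrightarrow> f j x * f j x"
      by (rule tendsto_mult)
    \<comment> \<open>The limit of the nonpositive products is a square.\<close>
    then have "f j x * f j x \<le> 0"
      using vw(3) LIMSEQ_le_const2 by blast
    then show ?thesis
      by (metis mult_le_0_iff order_antisym)
  qed
  with x show ?thesis
    by blast
qed

subsection \<open>Powers of the complement of a conic as Stein manifolds\<close>

definition hol_at :: "(complex ^ 'n::finite \<Rightarrow> complex) \<Rightarrow> complex ^ 'n \<Rightarrow> bool" where
  "hol_at f z \<longleftrightarrow> (\<exists>f'. (f has_derivative f') (at z) \<and> Vector_Spaces.linear (*s) (*) f')"

lemma holomorphic_sev_on_iff: "holomorphic_sev_on f S \<longleftrightarrow> (\<forall>z\<in>S. hol_at f z)"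
  by (simp add: holomorphic_sev_on_def hol_at_def)

lemma clinear_iff:
  fixes f :: "complex ^ 'n::finite \<Rightarrow> complex"
  shows "Vector_Spaces.linear (*s) (*) f \<longleftrightarrow>
    (\<forall>x y. f (x + y) = f x + f y) \<and> (\<forall>c x. f (c *s x) = c * f x)"
proof -
  have "vector_space ((*) :: complex \<Rightarrow> complex \<Rightarrow> complex)"
    by unfold_locales (auto simp: algebra_simps)
  then show ?thesis
    by (auto simp: Vector_Spaces.linear_iff vec.vector_space_axioms)
qed

lemma hol_at_const: "hol_at (\<lambda>z. c) z"
  unfolding hol_at_def clinear_iff by (rule exI[of _ "\<lambda>_. 0"]) auto

lemma hol_at_nth: "hol_at (\<lambda>z. z $ i) z"
  unfolding hol_at_def clinear_iff
  by (rule exI[of _ "\<lambda>h. h $ i"]) (auto intro!: bounded_linear_imp_has_derivative bounded_linear_vec_nth)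

lemma hol_at_add:
  assumes "hol_at f z" "hol_at g z"
  shows "hol_at (\<lambda>z. f z + g z) z"
proof -
  obtain f' g' where "(f has_derivative f') (at z)" "Vector_Spaces.linear (*s) (*) f'"
    "(g has_derivative g') (at z)" "Vector_Spaces.linear (*s) (*) g'"
    using assms by (auto simp: hol_at_def)
  then show ?thesis
    unfolding hol_at_def clinear_iff
    by (intro exI[of _ "\<lambda>h. f' h + g' h"] conjI has_derivative_add) (auto simp: algebra_simps)
qed

lemma hol_at_mult:
  assumes "hol_at f z" "hol_at g z"
  shows "hol_at (\<lambda>z. f z * g z) z"
proof -
  obtain f' g' where "(f has_derivative f') (at z)" "Vector_Spaces.linear (*s) (*) f'"
    "(g has_derivative g') (at z)" "Vector_Spaces.linear (*s) (*) g'"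
    using assms by (auto simp: hol_at_def)
  then show ?thesis
    unfolding hol_at_def clinear_iff
    by (intro exI[of _ "\<lambda>h. f z * g' h + f' h * g z"] conjI has_derivative_mult)
      (auto simp: algebra_simps)
qed

lemma hol_at_compose:
  assumes "hol_at f z" "g field_differentiable at (f z)"
  shows "hol_at (\<lambda>z. g (f z)) z"
proof -
  obtain f' where f': "(f has_derivative f') (at z)" "Vector_Spaces.linear (*s) (*) f'"
    using assms by (auto simp: hol_at_def)
  obtain D where "(g has_field_derivative D) (at (f z))"
    using assms by (auto simp: field_differentiable_def)
  then have "((\<lambda>z. g (f z)) has_derivative (\<lambda>h. D * f' h)) (at z)"
    using has_derivative_compose[OF f'(1)] by (simp add: has_field_derivative_def)
  then show ?thesis
    using f'(2) unfolding hol_at_def clinear_iff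
    by (intro exI[of _ "\<lambda>h. D * f' h"]) (auto simp: algebra_simps)
qed

lemma hol_at_diff:
  assumes "hol_at f z" "hol_at g z"
  shows "hol_at (\<lambda>z. f z - g z) z"
  using hol_at_add[OF assms(1) hol_at_mult[OF hol_at_const[of "-1"] assms(2)]] by simp

lemma hol_at_divide:
  assumes "hol_at f z" "hol_at g z" "g z \<noteq> 0"
  shows "hol_at (\<lambda>z. f z / g z) z"
proof -
  have "inverse field_differentiable at (g z)"
    using assms(3) field_differentiable_inverse[OF field_differentiable_ident, of "g z" UNIV] by simp
  then show ?thesis
    using hol_at_mult[OF assms(1) hol_at_compose[OF assms(2)]] by (simp add: divide_inverse)
qed

lemma hol_at_power: "hol_at f z \<Longrightarrow> hol_at (\<lambda>z. f z ^ k) z"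
  by (induction k) (auto intro: hol_at_const hol_at_mult)

lemma hol_at_sum: "(\<And>i. i \<in> A \<Longrightarrow> hol_at (f i) z) \<Longrightarrow> hol_at (\<lambda>z. \<Sum>i\<in>A. f i z) z"
  by (induction A rule: infinite_finite_induct) (auto intro: hol_at_const hol_at_add)

lemma hol_at_csqrt:
  assumes "hol_at f z" "f z \<notin> \<real>\<^sub>\<le>\<^sub>0"
  shows "hol_at (\<lambda>z. csqrt (f z)) z"
  using hol_at_compose[OF assms(1) field_differentiable_at_csqrt] assms(2) by blast

lemmas hol_at_intros = hol_at_const hol_at_nth hol_at_add hol_at_diff hol_at_mult hol_at_divide
  hol_at_power hol_at_sum hol_at_csqrt

lemma hol_at_cong_open:
  assumes "hol_at f z" "open S" "z \<in> S" "\<And>w. w \<in> S \<Longrightarrow> f w = g w"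
  shows "hol_at g z"
  using assms has_derivative_transform_within_open[of f _ z UNIV S g]
  unfolding hol_at_def by blast

lemma hol_at_isCont: "hol_at f z \<Longrightarrow> isCont f z"
  using has_derivative_continuous by (auto simp: hol_at_def)

section \<open>The complex quadratic form and its orthogonal matrices\<close>

text \<open>There is no conjugation: this is the complex bilinear form, whose nonzero isotropic
  vectors form the conic to be removed.\<close>

definition cdot :: "complex ^ 3 \<Rightarrow> complex ^ 3 \<Rightarrow> complex" where
  "cdot x y = (\<Sum>j\<in>UNIV. x $ j * y $ j)"

lemma cdot_scale [simp]: "cdot (a *s x) y = a * cdot x y" "cdot x (a *s y) = a * cdot x y"
  by (auto simp: cdot_def sum_distrib_left algebra_simps)

lemma cdot_commute: "cdot x y = cdot y x"
  by (simp add: cdot_def mult.commute)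

lemma cdot_add: "cdot (x + y) z = cdot x z + cdot y z" "cdot z (x + y) = cdot z x + cdot z y"
  by (auto simp: cdot_def sum.distrib algebra_simps)

lemma cdot_matrix: "cdot (A *v x) y = cdot x (transpose A *v y)"
proof -
  have "cdot (A *v x) y = (\<Sum>j\<in>UNIV. \<Sum>k\<in>UNIV. A $ j $ k * x $ k * y $ j)"
    by (simp add: cdot_def matrix_vector_mult_def sum_distrib_right)
  also have "\<dots> = (\<Sum>k\<in>UNIV. \<Sum>j\<in>UNIV. A $ j $ k * x $ k * y $ j)"
    by (rule sum.swap)
  also have "\<dots> = cdot x (transpose A *v y)"
    by (simp add: cdot_def matrix_vector_mult_def transpose_def sum_distrib_left ac_simps)
  finally show ?thesis .
qed

definition orthogonal_mat :: "complex ^ 3 ^ 3 \<Rightarrow> bool" where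
  "orthogonal_mat A \<longleftrightarrow> A ** transpose A = mat 1"

lemma orthogonal_mat_inverse:
  assumes "orthogonal_mat A"
  shows "A *v (transpose A *v x) = x" "transpose A *v (A *v x) = x"
proof -
  have "A ** transpose A = mat 1" "transpose A ** A = mat 1"
    using assms matrix_left_right_inverse by (auto simp: orthogonal_mat_def)
  then show "A *v (transpose A *v x) = x" "transpose A *v (A *v x) = x"
    by (simp_all only: matrix_vector_mul_assoc matrix_vector_mul_lid)
qed

lemma cdot_orthogonal:
  assumes "orthogonal_mat A"
  shows "cdot (A *v x) (A *v y) = cdot x y" "cdot (transpose A *v x) (transpose A *v y) = cdot x y"
  using orthogonal_mat_inverse[OF assms] cdot_matrix[of A x "A *v y"]
    cdot_matrix[of "transpose A" x "transpose A *v y"] by (simp_all add: transpose_transpose)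

text \<open>The witness is a Householder reflection, in \<open>z - e\<close> or in \<open>z + e\<close> with \<open>e\<close> the first unit
  vector: these two vectors are not both isotropic.\<close>

lemma householder_entries:
  fixes t a b c :: complex
  assumes "t * (a * a + b * b + c * c) = 2"
  shows "(1 - t * a * a) * (1 - t * a * a) + t * a * b * (t * a * b) + t * a * c * (t * a * c) = 1"
    and "t * a * b * (1 - t * b * b) + (1 - t * a * a) * (t * b * a) = t * a * c * (t * b * c)"
proof -
  have "(1 - t * a * a) * (1 - t * a * a) + t * a * b * (t * a * b) + t * a * c * (t * a * c) =
      1 + t * a * a * (t * (a * a + b * b + c * c) - 2)"
    by (simp add: algebra_simps)
  then show "(1 - t * a * a) * (1 - t * a * a) + t * a * b * (t * a * b) + t * a * c * (t * a * c) = 1"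
    by (simp add: assms)
  have "t * a * b * (1 - t * b * b) + (1 - t * a * a) * (t * b * a) - t * a * c * (t * b * c) =
      t * a * b * (2 - t * (a * a + b * b + c * c))"
    by (simp add: algebra_simps)
  then show "t * a * b * (1 - t * b * b) + (1 - t * a * a) * (t * b * a) = t * a * c * (t * b * c)"
    by (simp add: assms)
qed

lemma orthogonal_mat_first_row:
  assumes "cdot z z = 1"
  obtains A c where "orthogonal_mat A" "c\<^sup>2 = 1" "A $ 1 = c *s z"
proof -
  have z: "z $ 1 * z $ 1 + z $ 2 * z $ 2 + z $ 3 * z $ 3 = 1"
    using assms by (simp add: cdot_def sum_3)
  obtain c :: complex where c: "c\<^sup>2 = 1" "1 - c * z $ 1 \<noteq> 0"
  proof (cases "z $ 1 = 1")
    case True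
    then show ?thesis
      by (intro that[of "-1"]) auto
  next
    case False
    then show ?thesis
      by (intro that[of 1]) auto
  qed
  \<comment> \<open>With \<open>v = z - c e\<close> and \<open>c\<^sup>2 = 1\<close> one has
    \<open>v \<bullet> v = 2 (1 - c z\<^sub>1)\<close>, so \<open>t\<close> is the Householder
    factor \<open>2 / (v \<bullet> v)\<close>.\<close>
  define t where "t = 1 / (1 - c * z $ 1)"
  define v where "v = (\<chi> j. z $ j - (if j = 1 then c else 0))"
  define A :: "complex ^ 3 ^ 3" where "A = (\<chi> j k. (if j = k then 1 else 0) - t * v $ j * v $ k)"
  have t: "t * (1 - c * z $ 1) = 1"
    using c by (simp add: t_def)
  have cc: "c * c = 1"
    using c by (simp add: power2_eq_square)
  have v: "v $ 1 = z $ 1 - c" "v $ 2 = z $ 2" "v $ 3 = z $ 3"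
    by (auto simp: v_def)
  have tv: "t * (v $ 1 * v $ 1 + v $ 2 * v $ 2 + v $ 3 * v $ 3) = 2"
    unfolding v using t z cc by algebra
  have tv': "t * (v $ 2 * v $ 2 + v $ 1 * v $ 1 + v $ 3 * v $ 3) = 2"
    "t * (v $ 3 * v $ 3 + v $ 1 * v $ 1 + v $ 2 * v $ 2) = 2"
    "t * (v $ 1 * v $ 1 + v $ 3 * v $ 3 + v $ 2 * v $ 2) = 2"
    "t * (v $ 2 * v $ 2 + v $ 3 * v $ 3 + v $ 1 * v $ 1) = 2"
    "t * (v $ 3 * v $ 3 + v $ 2 * v $ 2 + v $ 1 * v $ 1) = 2"
    using tv by (simp_all add: ac_simps)
  have "orthogonal_mat A"
    unfolding orthogonal_mat_def vec_eq_iff forall_3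
    using householder_entries[OF tv] householder_entries[OF tv'(1)] householder_entries[OF tv'(2)]
      householder_entries[OF tv'(3)] householder_entries[OF tv'(4)] householder_entries[OF tv'(5)]
    by (simp add: matrix_matrix_mult_def transpose_def sum_3 A_def mat_def algebra_simps)
  \<comment> \<open>Since \<open>t v\<^sub>1 = - c\<close>, the first row is
    \<open>e + c v = c z\<close>.\<close>
  moreover have "A $ 1 = c *s z"
    unfolding vec_eq_iff forall_3 using t cc by (simp add: A_def v) (intro conjI; algebra)
  ultimately show ?thesis
    using that c(1) by blast
qed

section \<open>Square root coordinates on one factor\<close>

text \<open>
  If \<open>y \<bullet> y = 1\<close>, \<open>u = y\<^sub>1 y\<^sub>2\<close> and \<open>v = y\<^sub>1 y\<^sub>3\<close>, then \<open>w = y\<^sub>1\<^sup>2\<close> solves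
  \<open>w\<^sup>2 - w + u\<^sup>2 + v\<^sup>2 = 0\<close>; \<open>corner u v\<close> is the root with real part greater than \<open>1/2\<close>.
\<close>

definition disc :: "complex \<Rightarrow> complex \<Rightarrow> complex" where
  "disc u v = 1 - 4 * (u\<^sup>2 + v\<^sup>2)"

definition corner :: "complex \<Rightarrow> complex \<Rightarrow> complex" where
  "corner u v = (1 + csqrt (disc u v)) / 2"

definition lift :: "complex \<Rightarrow> complex \<Rightarrow> complex ^ 3" where
  "lift u v = vector [csqrt (corner u v), u / csqrt (corner u v), v / csqrt (corner u v)]"

lemma Re_csqrt_pos:
  assumes "z \<notin> \<real>\<^sub>\<le>\<^sub>0"
  shows "Re (csqrt z) > 0"
proof (rule ccontr)
  assume "\<not> ?thesis"
  then have "Re (csqrt z) = 0"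
    using csqrt_principal[of z] by auto
  then have "csqrt z = \<i> * Im (csqrt z)"
    by (simp add: complex_eq_iff)
  then have "z = - (complex_of_real (Im (csqrt z)))\<^sup>2"
    by (metis power2_csqrt power_mult_distrib power2_i mult_minus1)
  also have "\<dots> = complex_of_real (- (Im (csqrt z))\<^sup>2)"
    by simp
  also have "\<dots> \<in> \<real>\<^sub>\<le>\<^sub>0"
    by (subst nonpos_Reals_of_real_iff) simp
  finally show False
    using assms by simp
qed

lemma Re_corner: "disc u v \<notin> \<real>\<^sub>\<le>\<^sub>0 \<Longrightarrow> Re (corner u v) > 1 / 2"
  using Re_csqrt_pos[of "disc u v"] by (simp add: corner_def)

text \<open>Multiplied by \<open>y\<^sub>1\<^sup>2\<close>, the equation
  \<open>y \<bullet> y = 1\<close> becomes the quadratic equation solved by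
  \<open>corner u v\<close>, which is nonzero.\<close>

lemma lift_props:
  assumes "disc u v \<notin> \<real>\<^sub>\<le>\<^sub>0"
  shows "(lift u v $ 1)\<^sup>2 = corner u v" "lift u v $ 1 * lift u v $ 2 = u" "lift u v $ 1 * lift u v $ 3 = v"
    "cdot (lift u v) (lift u v) = 1" "lift u v $ 1 \<noteq> 0"
proof -
  have p0: "corner u v \<noteq> 0"
    using Re_corner[OF assms] by auto
  then have nz: "csqrt (corner u v) \<noteq> 0"
    by simp
  show 1: "(lift u v $ 1)\<^sup>2 = corner u v" "lift u v $ 1 * lift u v $ 2 = u"
    "lift u v $ 1 * lift u v $ 3 = v" "lift u v $ 1 \<noteq> 0"
    using nz by (auto simp: lift_def)
  define s where "s = csqrt (disc u v)"
  have s: "s * s = 1 - 4 * (u\<^sup>2 + v\<^sup>2)"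
    using power2_csqrt[of "disc u v"] by (simp add: s_def disc_def power2_eq_square)
  have p: "corner u v * corner u v + (u\<^sup>2 + v\<^sup>2) = corner u v"
  proof -
    have "2 * corner u v = 1 + s"
      by (simp add: corner_def s_def)
    with s have "4 * (corner u v * corner u v + (u\<^sup>2 + v\<^sup>2)) = 4 * corner u v"
      by algebra
    then show ?thesis
      by (simp only: mult_cancel_left) simp
  qed
  have "a\<^sup>2 * (a * a + b * b + c * c) = a\<^sup>2 * a\<^sup>2 + ((a * b)\<^sup>2 + (a * c)\<^sup>2)" for a b c :: complex
    by (simp add: algebra_simps power2_eq_square)
  from this[of "lift u v $ 1" "lift u v $ 2" "lift u v $ 3"]
  have "corner u v * cdot (lift u v) (lift u v) = corner u v * 1"
    unfolding cdot_def sum_3 1(1-3) p by simp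
  with p0 show "cdot (lift u v) (lift u v) = 1"
    by simp
qed

text \<open>Here the discriminant is \<open>(2 y\<^sub>1\<^sup>2 - 1)\<^sup>2\<close>, and the bound
  on the real part makes \<open>2 y\<^sub>1\<^sup>2 - 1\<close> its principal root. The second root,
  of \<open>y\<^sub>1\<^sup>2\<close>, is only determined up to the sign \<open>c\<close>, which is
  invisible in the projective plane.\<close>

lemma lift_inverse:
  assumes "cdot y y = 1" "Re ((y $ 1)\<^sup>2) > 1 / 2"
  defines "u \<equiv> y $ 1 * y $ 2" and "v \<equiv> y $ 1 * y $ 3"
  shows "disc u v \<notin> \<real>\<^sub>\<le>\<^sub>0" "\<exists>c. c\<^sup>2 = 1 \<and> lift u v = c *s y"
proof -
  have y: "y $ 1 * y $ 1 + y $ 2 * y $ 2 + y $ 3 * y $ 3 = 1"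
    using assms by (simp add: cdot_def sum_3)
  have d: "disc u v = (2 * (y $ 1)\<^sup>2 - 1)\<^sup>2"
    using y unfolding disc_def u_def v_def by algebra
  have pos: "Re (2 * (y $ 1)\<^sup>2 - 1) > 0"
    using assms by simp
  have s: "csqrt (disc u v) = 2 * (y $ 1)\<^sup>2 - 1"
    unfolding d using pos by (intro csqrt_square) simp
  show "disc u v \<notin> \<real>\<^sub>\<le>\<^sub>0"
  proof
    assume "disc u v \<in> \<real>\<^sub>\<le>\<^sub>0"
    then have "Re (csqrt (disc u v)) = 0"
      by (auto simp: complex_nonpos_Reals_iff csqrt_of_real_nonpos)
    then show False
      using pos unfolding s by simp
  qed
  have c: "corner u v = (y $ 1)\<^sup>2"
    by (simp add: corner_def s)
  have y1: "y $ 1 \<noteq> 0"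
    using assms(2) by auto
  have "csqrt (corner u v) = y $ 1 \<or> csqrt (corner u v) = - y $ 1"
    using power2_csqrt[of "corner u v"] by (simp only: c power2_eq_iff)
  then obtain c :: complex where c: "c\<^sup>2 = 1" "csqrt (corner u v) = c * y $ 1"
    by (metis mult_1 mult_minus1 one_power2 power2_minus)
  have cc: "c * c = 1" "c \<noteq> 0"
    using c by (auto simp: power2_eq_square)
  have "x / c = c * x" for x
    using cc by (metis mult.assoc mult.commute mult_1 nonzero_divide_eq_eq)
  then have "lift u v = c *s y"
    unfolding lift_def c vec_eq_iff forall_3 using y1 by (simp add: u_def v_def)
  then show "\<exists>c. c\<^sup>2 = 1 \<and> lift u v = c *s y"
    using c by blast
qed

section \<open>Encoding of tuples of matrices as sequences\<close>

text \<open>Points are sequences of complex numbers, so factor, row and column are coded by one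
  index.\<close>

definition encode :: "nat \<times> 3 \<times> 3 \<Rightarrow> nat" where
  "encode = to_nat"

definition decode :: "nat \<Rightarrow> nat \<times> 3 \<times> 3" where
  "decode = from_nat"

lemma decode_encode [simp]: "decode (encode t) = t"
  by (simp add: encode_def decode_def)

definition entry :: "(nat \<Rightarrow> complex) \<Rightarrow> nat \<Rightarrow> 3 \<Rightarrow> 3 \<Rightarrow> complex" where
  "entry q i j k = q (encode (i, j, k))"

text \<open>The entry \<open>(a, b)\<close> of \<open>A Q A\<^sup>T\<close> for the
  \<open>i\<close>-th matrix \<open>Q\<close> stored in \<open>q\<close>.\<close>

definition bilin :: "(complex ^ 3 ^ 3) \<Rightarrow> (nat \<Rightarrow> complex) \<Rightarrow> nat \<Rightarrow> 3 \<Rightarrow> 3 \<Rightarrow> complex" where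
  "bilin A q i a b = (\<Sum>j\<in>UNIV. \<Sum>k\<in>UNIV. A $ a $ j * entry q i j k * A $ b $ k)"

text \<open>
  The manifold \<open>X\<close> is the \<open>m\<close>-th power of the complement of the conic \<open>z \<bullet> z = 0\<close> in the projective
  plane, times \<open>p \<le> 1\<close> copies of the complex line. The point \<open>[z]\<close> is encoded by the matrix
  \<open>z z\<^sup>T / (z \<bullet> z)\<close>, which embeds the complement as an affine variety. All sequence entries that do
  not encode a matrix entry repeat the coordinate \<open>s\<close> on the line.
\<close>

locale conic_complement =
  fixes m p :: nat and \<iota> :: "'n::finite \<Rightarrow> nat"
  assumes p: "p \<le> 1" and \<iota>: "bij_betw \<iota> UNIV {..<2 * m + p}"
begin

definition pt :: "(nat \<Rightarrow> complex ^ 3) \<Rightarrow> complex \<Rightarrow> nat \<Rightarrow> complex" where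
  "pt x s n = (case decode n of (i, j, k) \<Rightarrow>
     if i < m then x i $ j * x i $ k / cdot (x i) (x i) else s)"

definition X :: "(nat \<Rightarrow> complex) set" where
  "X = {pt x s | x s. (\<forall>i<m. cdot (x i) (x i) \<noteq> 0) \<and> (p = 0 \<longrightarrow> s = 0)}"

definition frames :: "(nat \<Rightarrow> complex ^ 3 ^ 3) set" where
  "frames = {A. \<forall>i<m. orthogonal_mat (A i)}"

text \<open>For a representative \<open>z\<close> with \<open>z \<bullet> z = 1\<close> and
  \<open>y = A z\<close> the condition is that the real part of \<open>y\<^sub>1\<^sup>2\<close>
  exceeds \<open>1/2\<close>, as in \<open>lift_inverse\<close>; the chart then consists of
  \<open>y\<^sub>1 y\<^sub>2\<close> and \<open>y\<^sub>1 y\<^sub>3\<close> for each factor.\<close>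

definition domain :: "(nat \<Rightarrow> complex ^ 3 ^ 3) \<Rightarrow> (nat \<Rightarrow> complex) set" where
  "domain A = {q \<in> X. \<forall>i<m. Re (bilin (A i) q i 1 1) > 1 / 2}"

definition coords :: "(nat \<Rightarrow> complex ^ 3 ^ 3) \<Rightarrow> (nat \<Rightarrow> complex) \<Rightarrow> complex ^ 'n" where
  "coords A q = (\<chi> k. if \<iota> k < 2 * m
     then bilin (A (\<iota> k div 2)) q (\<iota> k div 2) 1 (if even (\<iota> k) then 2 else 3)
     else entry q m 1 1)"

definition slot :: "complex ^ 'n \<Rightarrow> nat \<Rightarrow> complex" where
  "slot u a = u $ (inv \<iota> a)"

text \<open>The image of every chart: it does not depend on the frame.\<close>

definition range_dom :: "(complex ^ 'n) set" where
  "range_dom = {u. \<forall>i<m. disc (slot u (2 * i)) (slot u (2 * i + 1)) \<notin> \<real>\<^sub>\<le>\<^sub>0}"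

definition point_of :: "(nat \<Rightarrow> complex ^ 3 ^ 3) \<Rightarrow> complex ^ 'n \<Rightarrow> nat \<Rightarrow> complex" where
  "point_of A u = pt (\<lambda>i. transpose (A i) *v lift (slot u (2 * i)) (slot u (2 * i + 1)))
     (if p = 0 then 0 else slot u (2 * m))"

definition atlas :: "(nat \<Rightarrow> complex, 'n) chart set" where
  "atlas = {(domain A, coords A) | A. A \<in> frames}"

section \<open>Charts and their holomorphic inverses\<close>

lemma slot_iota [simp]: "slot u (\<iota> k) = u $ k"
  using \<iota> by (simp add: slot_def bij_betw_def)

lemma iota_slot: "a < 2 * m + p \<Longrightarrow> \<iota> (inv \<iota> a) = a"
  using \<iota> by (auto simp: bij_betw_def intro: f_inv_into_f)

lemma iota_less: "\<iota> k < 2 * m + p"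
  using \<iota> by (auto simp: bij_betw_def)

lemma entry_pt: "entry (pt x s) i j k = (if i < m then x i $ j * x i $ k / cdot (x i) (x i) else s)"
  by (simp add: entry_def pt_def)

lemma bilin_pt:
  assumes "i < m"
  shows "bilin B (pt x s) i a b = (B *v x i) $ a * (B *v x i) $ b / cdot (x i) (x i)"
proof -
  have "bilin B (pt x s) i a b =
      (\<Sum>j\<in>UNIV. \<Sum>k\<in>UNIV. (B $ a $ j * x i $ j) * (B $ b $ k * x i $ k)) / cdot (x i) (x i)"
    using assms by (simp add: bilin_def entry_pt sum_divide_distrib ac_simps)
  then show ?thesis
    by (simp add: sum_product matrix_vector_mult_def)
qed

lemma pt_scale:
  assumes "\<And>i. i < m \<Longrightarrow> c i \<noteq> 0 \<and> x i = c i *s z i"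
  shows "pt x s = pt z s"
proof
  fix n
  obtain i j k where n: "decode n = (i, j, k)"
    by (metis prod_cases3)
  show "pt x s n = pt z s n"
    using assms[of i] by (auto simp: pt_def n)
qed

text \<open>Dividing each representative by a complex square root of \<open>x \<bullet> x\<close>
  normalises it without changing the projective point.\<close>

lemma X_normalE:
  assumes "q \<in> X"
  obtains z s where "q = pt z s" "\<And>i. i < m \<Longrightarrow> cdot (z i) (z i) = 1" "p = 0 \<Longrightarrow> s = 0"
proof -
  obtain x s where q: "q = pt x s" and x: "\<And>i. i < m \<Longrightarrow> cdot (x i) (x i) \<noteq> 0" and s: "p = 0 \<Longrightarrow> s = 0"
    using assms by (auto simp: X_def)
  define c where "c = (\<lambda>i. csqrt (cdot (x i) (x i)))"
  define z where "z = (\<lambda>i. inverse (c i) *s x i)"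
  have c: "c i \<noteq> 0" "c i * c i = cdot (x i) (x i)" if "i < m" for i
    using x[OF that] power2_csqrt[of "cdot (x i) (x i)"] by (auto simp: c_def power2_eq_square)
  have "pt x s = pt z s"
    using c by (intro pt_scale[where c = c]) (auto simp: z_def)
  moreover have "cdot (z i) (z i) = 1" if "i < m" for i
    using c[OF that] x[OF that] by (simp add: z_def field_simps)
  ultimately show ?thesis
    using that q s by blast
qed

lemma pt_in_X: "(\<And>i. i < m \<Longrightarrow> cdot (x i) (x i) \<noteq> 0) \<Longrightarrow> (p = 0 \<Longrightarrow> s = 0) \<Longrightarrow> pt x s \<in> X"
  by (auto simp: X_def)

lemma coords_eqI:
  assumes "\<And>i. i < m \<Longrightarrow> bilin (A i) q i 1 2 = slot u (2 * i)"
    and "\<And>i. i < m \<Longrightarrow> bilin (A i) q i 1 3 = slot u (2 * i + 1)"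
    and "p = 1 \<Longrightarrow> entry q m 1 1 = slot u (2 * m)"
  shows "coords A q = u"
  unfolding vec_eq_iff
proof
  fix k
  show "coords A q $ k = u $ k"
  proof (cases "\<iota> k < 2 * m")
    case True
    then have "\<iota> k div 2 < m" by auto
    moreover have "(if even (\<iota> k) then 2 * (\<iota> k div 2) else 2 * (\<iota> k div 2) + 1) = \<iota> k"
      by simp
    then have "slot u (if even (\<iota> k) then 2 * (\<iota> k div 2) else 2 * (\<iota> k div 2) + 1) = u $ k"
      by (simp only: slot_iota)
    ultimately show ?thesis
      using assms(1,2)[of "\<iota> k div 2"] True by (auto simp: coords_def split: if_splits)
  next
    case False
    with iota_less[of k] p have "\<iota> k = 2 * m" "p = 1" by auto
    then show ?thesis
      using assms(3) slot_iota[of u k] by (simp add: coords_def)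
  qed
qed

lemma slot_coords:
  assumes "i < m"
  shows "slot (coords A q) (2 * i) = bilin (A i) q i 1 2"
    "slot (coords A q) (2 * i + 1) = bilin (A i) q i 1 3"
  using assms iota_slot[of "2 * i"] iota_slot[of "2 * i + 1"] by (auto simp: slot_def coords_def)

lemma point_of:
  assumes A: "A \<in> frames" and u: "u \<in> range_dom"
  shows "point_of A u \<in> domain A" "coords A (point_of A u) = u"
proof -
  define y where "y = (\<lambda>i. lift (slot u (2 * i)) (slot u (2 * i + 1)))"
  define z where "z = (\<lambda>i. transpose (A i) *v y i)"
  define s where "s = (if p = 0 then 0 else slot u (2 * m))"
  have q: "point_of A u = pt z s"
    by (simp add: point_of_def z_def y_def s_def)
  have d: "disc (slot u (2 * i)) (slot u (2 * i + 1)) \<notin> \<real>\<^sub>\<le>\<^sub>0" if "i < m" for i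
    using u that by (auto simp: range_dom_def)
  have O: "orthogonal_mat (A i)" if "i < m" for i
    using A that by (auto simp: frames_def)
  have z1: "cdot (z i) (z i) = 1" if "i < m" for i
    using lift_props(4)[OF d[OF that]] cdot_orthogonal(2)[OF O[OF that]] by (simp only: z_def y_def)
  have Az: "A i *v z i = y i" if "i < m" for i
    unfolding z_def by (rule orthogonal_mat_inverse(1)[OF O[OF that]])
  have bil: "bilin (A i) (pt z s) i a b = y i $ a * y i $ b" if "i < m" for i a b
    by (simp only: bilin_pt[OF that] Az[OF that] z1[OF that] div_by_1)
  have "pt z s \<in> X"
    using z1 by (intro pt_in_X) (auto simp: s_def)
  moreover have "Re (bilin (A i) (pt z s) i 1 1) > 1 / 2" if "i < m" for i
    using lift_props(1)[OF d[OF that]] Re_corner[OF d[OF that]]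
    by (simp add: bil[OF that] y_def power2_eq_square)
  ultimately show "point_of A u \<in> domain A"
    by (simp add: domain_def q)
  show "coords A (point_of A u) = u"
    unfolding q
  proof (rule coords_eqI)
    fix i assume "i < m"
    then show "bilin (A i) (pt z s) i 1 2 = slot u (2 * i)"
      "bilin (A i) (pt z s) i 1 3 = slot u (2 * i + 1)"
      by (simp_all only: bil y_def lift_props(2,3)[OF d])
  qed (simp add: entry_pt s_def)
qed

lemma coords:
  assumes A: "A \<in> frames" and q: "q \<in> domain A"
  shows "coords A q \<in> range_dom" "point_of A (coords A q) = q"
proof -
  have "q \<in> X" using q by (simp add: domain_def)
  then obtain z s where qz: "q = pt z s" and z: "\<And>i. i < m \<Longrightarrow> cdot (z i) (z i) = 1"
    and s: "p = 0 \<Longrightarrow> s = 0"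
    by (rule X_normalE) blast
  define y where "y = (\<lambda>i. A i *v z i)"
  have O: "orthogonal_mat (A i)" if "i < m" for i
    using A that by (auto simp: frames_def)
  have y1: "cdot (y i) (y i) = 1" if "i < m" for i
    using z[OF that] cdot_orthogonal(1)[OF O[OF that]] by (simp add: y_def)
  have Ay: "transpose (A i) *v y i = z i" if "i < m" for i
    unfolding y_def by (rule orthogonal_mat_inverse(2)[OF O[OF that]])
  have bil: "bilin (A i) q i a b = y i $ a * y i $ b" if "i < m" for i a b
    by (simp add: qz bilin_pt that z y_def)
  have re: "Re ((y i $ 1)\<^sup>2) > 1 / 2" if "i < m" for i
    using q that by (simp add: domain_def bil power2_eq_square)
  have sl: "slot (coords A q) (2 * i) = y i $ 1 * y i $ 2"
    "slot (coords A q) (2 * i + 1) = y i $ 1 * y i $ 3" if "i < m" for i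
    by (simp_all only: slot_coords[OF that] bil[OF that])
  show "coords A q \<in> range_dom"
    unfolding range_dom_def using lift_inverse(1)[OF y1 re] by (auto simp only: sl)
  \<comment> \<open>The vectors are recovered only up to sign, which suffices because
    \<open>pt\<close> is invariant under rescaling.\<close>
  have "\<exists>c. c\<^sup>2 = 1 \<and> lift (slot (coords A q) (2 * i)) (slot (coords A q) (2 * i + 1)) = c *s y i"
    if "i < m" for i
    unfolding sl[OF that] by (rule lift_inverse(2)[OF y1[OF that] re[OF that]])
  then obtain c where c: "\<And>i. i < m \<Longrightarrow> (c i)\<^sup>2 = 1"
    and lift: "\<And>i. i < m \<Longrightarrow> lift (slot (coords A q) (2 * i)) (slot (coords A q) (2 * i + 1)) = c i *s y i"
    by metis
  have "c i \<noteq> 0" if "i < m" for i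
    using c[OF that] by auto
  moreover have "transpose (A i) *v (c i *s y i) = c i *s z i" if "i < m" for i
    using Ay[OF that] by (simp only: vector_scalar_commute)
  moreover have "(if p = 0 then 0 else slot (coords A q) (2 * m)) = s"
    using s p iota_slot[of "2 * m"] by (auto simp: slot_def coords_def qz entry_pt)
  ultimately show "point_of A (coords A q) = q"
    unfolding point_of_def by (subst (3) qz) (simp only: lift pt_scale[where c = c and z = z] simp_thms)
qed

lemma coords_image: "A \<in> frames \<Longrightarrow> coords A ` domain A = range_dom"
  using coords point_of by (auto simp: image_iff) (metis)

lemma inv_coords:
  assumes "A \<in> frames" "u \<in> range_dom"
  shows "inv_into (domain A) (coords A) u = point_of A u"
  using assms coords(2) point_of by (intro inv_into_f_eq inj_on_inverseI[where g = "point_of A"]) auto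

lemma open_range_dom: "open range_dom"
proof -
  have "range_dom = (\<Inter>i<m. (\<lambda>u. disc (slot u (2 * i)) (slot u (2 * i + 1))) -` (- \<real>\<^sub>\<le>\<^sub>0))"
    by (auto simp: range_dom_def)
  also have "open \<dots>"
    unfolding disc_def slot_def
    by (intro open_INT finite_lessThan ballI open_vimage continuous_intros open_Compl
        closed_nonpos_Reals_complex)
  finally show ?thesis .
qed

lemma continuous_on_entry [continuous_intros]: "continuous_on S (\<lambda>q. entry q i j k)"
  unfolding entry_def by (rule continuous_on_subset[OF continuous_on_product_coordinates]) auto

lemma continuous_on_bilin [continuous_intros]: "continuous_on S (\<lambda>q. bilin B q i a b)"
  unfolding bilin_def by (intro continuous_intros)

lemma continuous_on_coords: "continuous_on S (coords A)"
  unfolding coords_def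
proof (intro continuous_on_vec_lambda)
  fix k
  show "continuous_on S (\<lambda>q. if \<iota> k < 2 * m
     then bilin (A (\<iota> k div 2)) q (\<iota> k div 2) 1 (if even (\<iota> k) then 2 else 3)
     else entry q m 1 1)"
    by (cases "\<iota> k < 2 * m") (auto intro!: continuous_intros)
qed

lemma hol_at_lift:
  assumes "hol_at f z" "hol_at g z" "disc (f z) (g z) \<notin> \<real>\<^sub>\<le>\<^sub>0"
  shows "hol_at (\<lambda>z. lift (f z) (g z) $ j) z"
proof -
  have p: "Re (corner (f z) (g z)) > 1 / 2"
    by (rule Re_corner[OF assms(3)])
  then have p': "corner (f z) (g z) \<notin> \<real>\<^sub>\<le>\<^sub>0" "csqrt (corner (f z) (g z)) \<noteq> 0"
    by (auto simp: complex_nonpos_Reals_iff)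
  have d: "hol_at (\<lambda>z. disc (f z) (g z)) z"
    unfolding disc_def by (intro hol_at_intros assms)
  have "hol_at (\<lambda>z. corner (f z) (g z)) z"
    unfolding corner_def by (intro hol_at_intros d assms) auto
  then have c: "hol_at (\<lambda>z. csqrt (corner (f z) (g z))) z"
    by (intro hol_at_csqrt p')
  show ?thesis
    using exhaust_3[of j] c p'(2) by (auto simp: lift_def intro!: hol_at_divide assms)
qed

lemma hol_at_point_of:
  assumes A: "A \<in> frames" and u: "u \<in> range_dom"
  shows "hol_at (\<lambda>u. point_of A u n) u"
proof -
  obtain i j k where n: "decode n = (i, j, k)"
    by (metis prod_cases3)
  show ?thesis
  proof (cases "i < m")
    case True
    have d: "disc (slot u (2 * i)) (slot u (2 * i + 1)) \<notin> \<real>\<^sub>\<le>\<^sub>0"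
      using u True by (auto simp: range_dom_def)
    define z where "z = (\<lambda>u. transpose (A i) *v lift (slot u (2 * i)) (slot u (2 * i + 1)))"
    have z: "hol_at (\<lambda>u. z u $ j) u" for j
      unfolding z_def matrix_vector_mult_def slot_def vec_lambda_beta
      using d by (intro hol_at_intros hol_at_lift) (auto simp: slot_def)
    have "cdot (z u) (z u) = 1"
      unfolding z_def using A True lift_props(4)[OF d] cdot_orthogonal(2)[of "A i"]
      by (simp only: frames_def mem_Collect_eq)
    moreover have "hol_at (\<lambda>u. cdot (z u) (z u)) u"
      unfolding cdot_def by (intro hol_at_intros z)
    ultimately have "hol_at (\<lambda>u. z u $ j * z u $ k / cdot (z u) (z u)) u"
      by (intro hol_at_intros z) auto
    then show ?thesis
      using True by (simp only: point_of_def pt_def n z_def prod.case if_True)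
  next
    case False
    then have "(\<lambda>u. point_of A u n) = (\<lambda>u. if p = 0 then 0 else slot u (2 * m))"
      by (simp add: point_of_def pt_def n)
    then show ?thesis
      by (cases "p = 0") (auto simp: slot_def intro: hol_at_const hol_at_nth)
  qed
qed

lemma hol_at_inv_coords:
  assumes "A \<in> frames" "u \<in> range_dom" "hol_at (\<lambda>u. G (point_of A u)) u"
  shows "hol_at (\<lambda>u. G (inv_into (domain A) (coords A) u)) u"
  using assms(3) open_range_dom assms(2)
  by (rule hol_at_cong_open) (simp add: inv_coords assms(1))

lemma continuous_on_point_of:
  assumes A: "A \<in> frames"
  shows "continuous_on range_dom (point_of A)"
  using hol_at_isCont[OF hol_at_point_of[OF A]]
  by (intro continuous_on_coordinatewise_then_product) (simp add: continuous_at_imp_continuous_on)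

section \<open>The atlas and the manifold structure\<close>

lemma domain_subset: "domain A \<subseteq> X"
  by (auto simp: domain_def)

lemma openin_domain: "openin (top_of_set X) (domain A)"
proof -
  have "domain A = X \<inter> (\<Inter>i<m. {q. Re (bilin (A i) q i 1 1) > 1 / 2})"
    by (auto simp: domain_def)
  moreover have "open (\<Inter>i<m. {q. Re (bilin (A i) q i 1 1) > 1 / 2})"
    by (intro open_INT finite_lessThan ballI open_Collect_less continuous_intros)
  ultimately show ?thesis
    by (auto simp: openin_open)
qed

lemma topological_chart_coords:
  assumes A: "A \<in> frames"
  shows "topological_chart (top_of_set X) (domain A, coords A)"
proof -
  have "homeomorphic_maps (top_of_set (domain A)) (top_of_set range_dom) (coords A) (point_of A)"
    unfolding homeomorphic_maps_def
    using continuous_on_coords[of "domain A" A] continuous_on_point_of[OF A] coords[OF A] point_of[OF A]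
    by (auto simp: image_subset_iff)
  then have "homeomorphic_map (top_of_set (domain A)) (top_of_set range_dom) (coords A)"
    by (meson homeomorphic_map_maps)
  moreover have "X \<inter> domain A = domain A"
    using domain_subset by blast
  ultimately show ?thesis
    by (simp add: topological_chart_def openin_domain coords_image[OF A] open_range_dom subtopology_subtopology)
qed

lemma hol_at_coords_point_of:
  assumes "A \<in> frames" "u \<in> range_dom"
  shows "hol_at (\<lambda>u. coords B (point_of A u) $ k) u"
  unfolding coords_def vec_lambda_beta bilin_def entry_def
  by (cases "\<iota> k < 2 * m"; simp only: if_True if_False; intro hol_at_intros hol_at_point_of assms)

lemma holomorphic_transition_coords:
  assumes "A \<in> frames" "B \<in> frames"
  shows "holomorphic_transition (domain A, coords A) (domain B, coords B)"
proof -
  have "u \<in> range_dom" if "u \<in> coords A ` (domain A \<inter> domain B)" for u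
    using that coords(1)[OF assms(1)] by auto
  then show ?thesis
    unfolding holomorphic_transition_def holomorphic_sev_on_iff prod.case
    using assms by (auto intro: hol_at_inv_coords[where G = "\<lambda>q. coords B q $ _"] hol_at_coords_point_of)
qed

lemma holomorphic_functions_atlas:
  "f \<in> holomorphic_functions atlas \<longleftrightarrow>
    (\<forall>A\<in>frames. \<forall>u\<in>range_dom. hol_at (f \<circ> inv_into (domain A) (coords A)) u)"
proof -
  have "(\<forall>c\<in>atlas. P c) \<longleftrightarrow> (\<forall>A\<in>frames. P (domain A, coords A))" for P
    by (auto simp: atlas_def)
  then show ?thesis
    unfolding holomorphic_functions_def
    by (simp only: mem_Collect_eq prod.case holomorphic_sev_on_iff coords_image cong: ball_cong)
qed

lemma holomorphic_coordinate: "(\<lambda>q. q n) \<in> holomorphic_functions atlas"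
  unfolding holomorphic_functions_atlas comp_def
  by (intro ballI hol_at_inv_coords[where G = "\<lambda>q. q n"] hol_at_point_of)

lemma holomorphic_coords: "(\<lambda>q. coords A q $ k) \<in> holomorphic_functions atlas"
  unfolding holomorphic_functions_atlas comp_def
  by (intro ballI hol_at_inv_coords[where G = "\<lambda>q. coords A q $ k"] hol_at_coords_point_of)

text \<open>A frame with first row \<open>c z\<close> and \<open>c\<^sup>2 = 1\<close> rotates
  \<open>z\<close> to a vector with first coordinate \<open>c\<close>, so the quantity bounded in
  \<open>domain\<close> equals 1. The coordinate \<open>s\<close> does not enter, hence one frame
  serves all its values.\<close>

lemma frame_exists:
  assumes "\<And>i. i < m \<Longrightarrow> cdot (z i) (z i) = 1"
  shows "\<exists>A\<in>frames. \<exists>c. (\<forall>i<m. (c i)\<^sup>2 = 1 \<and> A i $ 1 = c i *s z i) \<and>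
    (\<forall>s. (p = 0 \<longrightarrow> s = 0) \<longrightarrow> pt z s \<in> domain A)"
proof -
  have "\<exists>A c. orthogonal_mat A \<and> c\<^sup>2 = 1 \<and> A $ 1 = c *s z i" if "i < m" for i
    using orthogonal_mat_first_row[OF assms[OF that]] by metis
  then obtain A c where A: "\<And>i. i < m \<Longrightarrow> orthogonal_mat (A i)"
    and c: "\<And>i. i < m \<Longrightarrow> (c i)\<^sup>2 = 1" and A1: "\<And>i. i < m \<Longrightarrow> A i $ 1 = c i *s z i"
    by metis
  have "(A i *v z i) $ 1 = c i" if "i < m" for i
  proof -
    have "(A i *v z i) $ 1 = cdot (A i $ 1) (z i)"
      by (simp add: matrix_vector_mult_def cdot_def)
    then show ?thesis
      by (simp add: A1 assms that)
  qed
  then have "bilin (A i) (pt z s) i 1 1 = 1" if "i < m" for i s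
    using c[OF that] by (simp add: bilin_pt that assms power2_eq_square)
  then have "pt z s \<in> domain A" if "p = 0 \<longrightarrow> s = 0" for s
    unfolding domain_def using that assms by (auto intro!: pt_in_X)
  moreover have "A \<in> frames"
    using A by (simp add: frames_def)
  ultimately show ?thesis
    using A1 c by (intro bexI[of _ A] exI[of _ c]) auto
qed

lemma X_domainE:
  assumes "q \<in> X"
  obtains A where "A \<in> frames" "q \<in> domain A"
proof -
  obtain z s where q: "q = pt z s" and z: "\<And>i. i < m \<Longrightarrow> cdot (z i) (z i) = 1" and s: "p = 0 \<Longrightarrow> s = 0"
    using assms by (rule X_normalE) blast
  obtain A where "A \<in> frames" "q \<in> domain A"
    using frame_exists[of z] z q s by blast
  then show ?thesis
    by (rule that)
qed

lemma domain_cover: "(\<Union>c\<in>atlas. fst c) = X"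
proof -
  have "(\<Union>c\<in>atlas. fst c) = (\<Union>A\<in>frames. domain A)"
    by (auto simp: atlas_def)
  also have "\<dots> = X"
    using domain_subset by (blast elim: X_domainE)
  finally show ?thesis .
qed

lemma complex_manifold_atlas: "complex_manifold (top_of_set X) atlas"
proof -
  have "second_countable (euclidean :: (nat \<Rightarrow> complex) topology)"
  proof -
    obtain \<B> :: "(nat \<Rightarrow> complex) set set" where "countable \<B>" "\<And>C. C \<in> \<B> \<Longrightarrow> open C"
      and "\<And>S. open S \<Longrightarrow> \<exists>U. U \<subseteq> \<B> \<and> S = \<Union>U"
      by (rule univ_second_countable) blast
    then show ?thesis
      unfolding second_countable_def open_openin[symmetric] by (intro exI[of _ \<B>]) blast
  qed
  then have "second_countable (top_of_set X)"
    by (rule second_countable_subtopology)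
  moreover have "Hausdorff_space (top_of_set X)"
    by (intro Hausdorff_space_subtopology Hausdorff_space_euclidean)
  ultimately show ?thesis
    unfolding complex_manifold_def domain_cover
    using topological_chart_coords holomorphic_transition_coords by (auto simp: atlas_def)
qed

lemma continuous_on_holomorphic:
  assumes f: "f \<in> holomorphic_functions atlas"
  shows "continuous_on X f"
  unfolding continuous_on_eq_continuous_within
proof
  fix q assume "q \<in> X"
  then obtain A where A: "A \<in> frames" and q: "q \<in> domain A"
    by (rule X_domainE)
  let ?h = "f \<circ> inv_into (domain A) (coords A)"
  have "continuous_on range_dom ?h"
    using f A unfolding holomorphic_functions_atlas
    by (intro continuous_at_imp_continuous_on ballI hol_at_isCont) blast
  then have "continuous_on (domain A) (\<lambda>q. ?h (coords A q))"
    using continuous_on_coords coords(1)[OF A]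
    by (intro continuous_on_compose2[of range_dom ?h "domain A" "coords A"]) auto
  moreover have "?h (coords A q) = f q" if "q \<in> domain A" for q
    using that coords[OF A] by (simp add: inv_coords[OF A])
  ultimately have "continuous_on (domain A) f"
    by (simp cong: continuous_on_cong)
  then have "continuous (at q within domain A) f"
    using q by (simp add: continuous_on_eq_continuous_within)
  moreover obtain U where U: "open U" "domain A = X \<inter> U"
    using openin_domain[of A] by (auto simp: openin_open)
  then have "at q within domain A = at q within X"
    using q by (intro at_within_nhd[of q U]) auto
  ultimately show "continuous (at q within X) f"
    by simp
qed

section \<open>Closedness and the Stein property\<close>

text \<open>Some diagonal entry is nonzero because the trace is. The row through it, divided by a
  root of that entry, is the required vector by the minor relations.\<close>

lemma rank_one_matrix:
  fixes E :: "3 \<Rightarrow> 3 \<Rightarrow> complex"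
  assumes sym: "\<And>j k. E j k = E k j" and minor: "\<And>j k a b. E j k * E a b = E j b * E a k"
    and trace: "(\<Sum>j\<in>UNIV. E j j) = 1"
  obtains z where "cdot z z = 1" "\<And>j k. E j k = z $ j * z $ k"
proof -
  obtain d where d: "E d d \<noteq> 0"
  proof -
    have "\<not> (\<forall>d. E d d = 0)"
    proof
      assume "\<forall>d. E d d = 0"
      with trace show False
        by simp
    qed
    then show ?thesis
      using that by blast
  qed
  define c where "c = csqrt (E d d)"
  have c: "c \<noteq> 0" "c * c = E d d"
    using d power2_csqrt[of "E d d"] by (auto simp: c_def power2_eq_square)
  define z :: "complex ^ 3" where "z = (\<chi> j. E d j / c)"
  have E: "E j k = z $ j * z $ k" for j k
  proof -
    have "E j k * (c * c) = E d j * E d k"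
      using minor[of j k d d] sym[of j d] c(2) by simp
    then have "E j k = E d j * E d k / (c * c)"
      using c(1) by (simp add: nonzero_eq_divide_eq)
    then show ?thesis
      by (simp add: z_def)
  qed
  have "cdot z z = 1"
    using trace by (simp add: cdot_def flip: E)
  then show ?thesis
    using that E by blast
qed

text \<open>These are polynomial equations for symmetric matrices of rank one and trace 1, which
  make the closedness of \<open>X\<close> evident. The first condition ties the terms at indices
  that are not codes to the entries they decode to.\<close>

lemma X_iff:
  "q \<in> X \<longleftrightarrow> (\<forall>n. q n = q (encode (decode n))) \<and>
    (\<forall>i j k. i < m \<longrightarrow> entry q i j k = entry q i k j) \<and>
    (\<forall>i j k a b. i < m \<longrightarrow> entry q i j k * entry q i a b = entry q i j b * entry q i a k) \<and>
    (\<forall>i. i < m \<longrightarrow> (\<Sum>j\<in>UNIV. entry q i j j) = 1) \<and>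
    (\<forall>i j k. m \<le> i \<longrightarrow> entry q i j k = entry q m 1 1) \<and> (p = 0 \<longrightarrow> entry q m 1 1 = 0)"
  (is "_ \<longleftrightarrow> ?R")
proof
  assume "q \<in> X"
  then obtain z s where q: "q = pt z s" and z: "\<And>i. i < m \<Longrightarrow> cdot (z i) (z i) = 1" and "p = 0 \<Longrightarrow> s = 0"
    by (rule X_normalE) blast
  moreover have "(\<Sum>j\<in>UNIV. z i $ j * z i $ j) = 1" if "i < m" for i
    using z[OF that] by (simp add: cdot_def)
  ultimately show ?R
    by (simp add: entry_pt) (simp add: pt_def)
next
  assume R: ?R
  have "\<exists>z. cdot z z = 1 \<and> (\<forall>j k. entry q i j k = z $ j * z $ k)" if "i < m" for i
  proof (rule rank_one_matrix[of "entry q i"])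
    show "entry q i j k = entry q i k j" for j k
      using R that by blast
    show "entry q i j k * entry q i a b = entry q i j b * entry q i a k" for j k a b
      using R that by blast
    show "(\<Sum>j\<in>UNIV. entry q i j j) = 1"
      using R that by blast
  qed blast
  then obtain z where z: "\<And>i. i < m \<Longrightarrow> cdot (z i) (z i) = 1"
    "\<And>i j k. i < m \<Longrightarrow> entry q i j k = z i $ j * z i $ k"
    by metis
  have "q = pt z (entry q m 1 1)"
  proof
    fix n
    obtain i j k where n: "decode n = (i, j, k)"
      by (metis prod_cases3)
    have "q n = entry q i j k"
      using R unfolding entry_def n[symmetric] by blast
    also have "\<dots> = pt z (entry q m 1 1) n"
    proof (cases "i < m")
      case True
      then show ?thesis
        by (simp add: pt_def n z)
    next
      case False
      then have "entry q i j k = entry q m 1 1"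
        using R by (meson not_less)
      then show ?thesis
        using False by (simp add: pt_def n)
    qed
    finally show "q n = pt z (entry q m 1 1) n" .
  qed
  moreover have "p = 0 \<longrightarrow> entry q m 1 1 = 0"
    using R by blast
  ultimately show "q \<in> X"
    using z(1) pt_in_X[of z "entry q m 1 1"] by simp
qed

lemma closed_X: "closed X"
proof -
  have "X = {q. q \<in> X}"
    by simp
  also have "closed \<dots>"
    unfolding X_iff entry_def
    by (intro closed_Collect_conj closed_Collect_all closed_Collect_imp open_Collect_const closed_Collect_eq
        continuous_intros continuous_on_product_coordinates)
  finally show ?thesis .
qed

text \<open>The sequence coordinates are holomorphic, so the hull lies in a product of closed discs,
  compact by Tychonoff's theorem. It is closed because \<open>X\<close> is.\<close>

lemma compact_holomorphic_hull:
  assumes K: "compactin (top_of_set X) K"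
  shows "compactin (top_of_set X) (holomorphic_hull (top_of_set X) atlas K)"
proof -
  let ?c = "\<lambda>f. SUP y\<in>K. ereal (cmod (f y))"
  let ?hull = "holomorphic_hull (top_of_set X) atlas K"
  have hull: "?hull = {x \<in> X. \<forall>f\<in>holomorphic_functions atlas. ereal (cmod (f x)) \<le> ?c f}"
    by (simp add: holomorphic_hull_def)
  have K: "compact K"
    using K by (simp add: compactin_subtopology)
  have "\<exists>B. \<forall>y\<in>K. cmod (y n) \<le> B" for n
  proof -
    have "compact ((\<lambda>y. y n) ` K)"
      by (intro compact_continuous_image continuous_on_subset[OF continuous_on_product_coordinates] K) auto
    then have "bounded ((\<lambda>y. y n) ` K)"
      by (rule compact_imp_bounded)
    then show ?thesis
      by (auto simp: bounded_iff)
  qed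
  then obtain B where B: "\<And>n y. y \<in> K \<Longrightarrow> cmod (y n) \<le> B n"
    by metis
  have sub: "?hull \<subseteq> {x. \<forall>n. x n \<in> cball 0 (B n)}"
  proof safe
    fix x n assume "x \<in> ?hull"
    then have "ereal (cmod (x n)) \<le> (SUP y\<in>K. ereal (cmod (y n)))"
      using holomorphic_coordinate[of n] by (auto simp: hull)
    also have "\<dots> \<le> ereal (B n)"
      using B by (intro SUP_least) simp
    finally show "x n \<in> cball 0 (B n)"
      by simp
  qed
  have "compact {x::nat \<Rightarrow> complex. \<forall>n. x n \<in> cball 0 (B n)}"
    by (intro compact_componentwise compact_cball)
  moreover have "closed ?hull"
  proof -
    have "closedin (top_of_set X) (X \<inter> (\<lambda>x. ereal (cmod (f x))) -` {..?c f})"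
      if "f \<in> holomorphic_functions atlas" for f
      using continuous_on_holomorphic[OF that]
      by (intro continuous_closedin_preimage continuous_on_ereal continuous_on_norm) auto
    then have "closed (X \<inter> (\<lambda>x. ereal (cmod (f x))) -` {..?c f})"
      if "f \<in> holomorphic_functions atlas" for f
      using closed_X closedin_closed_trans that by blast
    then have "closed (X \<inter> (\<Inter>f\<in>holomorphic_functions atlas. X \<inter> (\<lambda>x. ereal (cmod (f x))) -` {..?c f}))"
      by (intro closed_Int[OF closed_X closed_INT]) blast
    also have "X \<inter> (\<Inter>f\<in>holomorphic_functions atlas. X \<inter> (\<lambda>x. ereal (cmod (f x))) -` {..?c f}) = ?hull"
      unfolding hull by auto
    finally show ?thesis .
  qed
  ultimately have "compact ({x. \<forall>n. x n \<in> cball 0 (B n)} \<inter> ?hull)"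
    by (intro compact_Int_closed)
  with sub have "compact ?hull"
    by (simp add: inf.absorb2)
  then show ?thesis
    by (auto simp: compactin_subtopology hull)
qed

text \<open>The sequence coordinates separate points, and each chart map is linear in the matrix
  entries, hence consists of global holomorphic functions.\<close>

theorem stein_manifold_atlas: "stein_manifold (top_of_set X) atlas"
proof -
  have "\<exists>f\<in>holomorphic_functions atlas. f x \<noteq> f y" if ne: "x \<noteq> y" for x y
  proof -
    obtain n where "x n \<noteq> y n"
      using ne by auto
    then show ?thesis
      by (intro bexI[where x = "\<lambda>q. q n"] holomorphic_coordinate)
  qed
  moreover have "\<exists>g. (\<forall>i. g i \<in> holomorphic_functions atlas) \<and>
      (\<exists>U. x \<in> U \<and> compatible_chart (top_of_set X) atlas (U, \<lambda>y. \<chi> i. g i y))" if "x \<in> X" for x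
  proof -
    obtain A where A: "A \<in> frames" "x \<in> domain A"
      using \<open>x \<in> X\<close> by (rule X_domainE)
    have "compatible_chart (top_of_set X) atlas (domain A, coords A)"
      unfolding compatible_chart_def
      using topological_chart_coords holomorphic_transition_coords A(1) by (auto simp: atlas_def)
    moreover have "coords A = (\<lambda>y. \<chi> i. coords A y $ i)"
      by (simp only: vec_lambda_eta)
    ultimately show ?thesis
      using A(2) holomorphic_coords
      by (intro exI[of _ "\<lambda>i y. coords A y $ i"] conjI exI[of _ "domain A"]) auto
  qed
  ultimately show ?thesis
    unfolding stein_manifold_def using complex_manifold_atlas compact_holomorphic_hull by auto
qed

end

subsection \<open>Immersions of powers of the complement of a conic\<close>

lemma has_derivative_vecI:
  fixes f :: "'a::real_normed_vector \<Rightarrow> 'b::real_normed_vector ^ 'n::finite"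
  assumes "bounded_linear f'" "\<And>i. ((\<lambda>x. f x $ i) has_derivative (\<lambda>h. f' h $ i)) (at x within S)"
  shows "(f has_derivative f') (at x within S)"
  using assms unfolding has_derivative_def
  by (auto intro!: vec_tendstoI)

text \<open>Cauchy's inequality bounds the difference of the derivatives by that of the functions on
  the circle of radius \<open>r\<close>, which is small by uniform continuity.\<close>

lemma continuous_on_deriv_parameter:
  fixes g :: "'a::metric_space \<Rightarrow> complex \<Rightarrow> complex"
  assumes S: "compact S" and r: "0 < r"
    and cont: "continuous_on (S \<times> cball 0 r) (\<lambda>(c, t). g c t)"
    and hol: "\<And>c. c \<in> S \<Longrightarrow> g c holomorphic_on ball 0 r"
  shows "continuous_on S (\<lambda>c. deriv (g c) 0)"
proof -
  have uc: "uniformly_continuous_on (S \<times> cball 0 r) (\<lambda>(c, t). g c t)"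
    using cont S by (intro compact_uniformly_continuous compact_Times compact_cball)
  have cont1: "continuous_on (cball 0 r) (g c)" if "c \<in> S" for c
  proof -
    have "continuous_on (cball 0 r) (\<lambda>t. (c, t))"
      by (intro continuous_on_Pair continuous_on_const continuous_on_id)
    then have "continuous_on (cball 0 r) (\<lambda>t. case (c, t) of (c, t) \<Rightarrow> g c t)"
      using that by (intro continuous_on_compose2[OF cont]) auto
    then show ?thesis
      by simp
  qed
  show ?thesis
    unfolding continuous_on_iff
  proof (intro ballI allI impI)
    fix c :: "'a" and e :: real
    assume c: "c \<in> S" and e: "0 < e"
    obtain d where d: "d > 0" and D: "\<And>x y. x \<in> S \<times> cball 0 r \<Longrightarrow> y \<in> S \<times> cball 0 r \<Longrightarrow>
        dist y x < d \<Longrightarrow> dist (case y of (c, t) \<Rightarrow> g c t) (case x of (c, t) \<Rightarrow> g c t) < e * r / 2"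
      using uc e r unfolding uniformly_continuous_on_def by (metis half_gt_zero mult_pos_pos)
    have "dist (deriv (g c') 0) (deriv (g c) 0) < e" if c': "c' \<in> S" "dist c' c < d" for c'
    proof -
      have hol0: "g c' field_differentiable at 0" "g c field_differentiable at 0"
        using hol[OF c'(1)] hol[OF c] r by (auto simp: holomorphic_on_open field_differentiable_def)
      have "norm ((deriv ^^ 1) (\<lambda>t. g c' t - g c t) 0) \<le> fact 1 * (e * r / 2) / r ^ 1"
      proof (rule Cauchy_inequality)
        show "(\<lambda>t. g c' t - g c t) holomorphic_on ball 0 r"
          using hol c c' by (intro holomorphic_intros)
        show "continuous_on (cball 0 r) (\<lambda>t. g c' t - g c t)"
          using cont1 c c' by (intro continuous_intros)
        show "norm (g c' t - g c t) \<le> e * r / 2" if "norm (0 - t) = r" for t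
          using D[of "(c, t)" "(c', t)"] c c' that by (auto simp: dist_Pair_Pair dist_norm)
      qed (use r in auto)
      then have "norm (deriv (g c') 0 - deriv (g c) 0) \<le> e / 2"
        using r hol0 by simp
      with e show ?thesis
        by (simp add: dist_norm)
    qed
    with d show "\<exists>d>0. \<forall>c'\<in>S. dist c' c < d \<longrightarrow> dist (deriv (g c') 0) (deriv (g c) 0) < e"
      by blast
  qed
qed

text \<open>
  The matrix \<open>((x\<^sub>1, x\<^sub>2 + \<i> x\<^sub>3), (x\<^sub>2 - \<i> x\<^sub>3, - x\<^sub>1))\<close> depends linearly on \<open>x\<close> and is invertible for
  real \<open>x \<noteq> 0\<close>. It trivialises twice the complexified tautological line bundle over the real
  projective plane.
\<close>

definition quat1 :: "complex ^ 3 \<Rightarrow> complex \<Rightarrow> complex \<Rightarrow> complex" where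
  "quat1 x u v = x $ 1 * u + (x $ 2 + \<i> * x $ 3) * v"

definition quat2 :: "complex ^ 3 \<Rightarrow> complex \<Rightarrow> complex \<Rightarrow> complex" where
  "quat2 x u v = (x $ 2 - \<i> * x $ 3) * u - x $ 1 * v"

lemma quat_eq_0:
  assumes "quat1 x u v = 0" "quat2 x u v = 0" "cdot x x \<noteq> 0"
  shows "u = 0" "v = 0"
proof -
  have "cdot x x * u = x $ 1 * quat1 x u v + (x $ 2 + \<i> * x $ 3) * quat2 x u v"
    "cdot x x * v = (x $ 2 - \<i> * x $ 3) * quat1 x u v - x $ 1 * quat2 x u v"
    by (simp_all add: quat1_def quat2_def cdot_def sum_3 algebra_simps)
  with assms show "u = 0" "v = 0"
    by auto
qed

lemma quat_minus [simp]:
  "quat1 (- x) u v = - quat1 x u v" "quat2 (- x) u v = - quat2 x u v"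
  "quat1 x (- u) (- v) = - quat1 x u v" "quat2 x (- u) (- v) = - quat2 x u v"
  by (simp_all add: quat1_def quat2_def algebra_simps)

section \<open>Tangent vectors represented by curves\<close>

context conic_complement
begin

lemma bilin_curve_deriv:
  assumes i: "i < m" and N: "cdot (x i + t *s w i) (x i + t *s w i) \<noteq> 0"
  shows "((\<lambda>t. bilin B (pt (\<lambda>i. x i + t *s w i) (t * \<sigma>)) i a b) has_field_derivative
    (((B *v w i) $ a * (B *v (x i + t *s w i)) $ b + (B *v (x i + t *s w i)) $ a * (B *v w i) $ b) *
       cdot (x i + t *s w i) (x i + t *s w i) -
     (B *v (x i + t *s w i)) $ a * (B *v (x i + t *s w i)) $ b * (2 * cdot (x i + t *s w i) (w i))) /
    (cdot (x i + t *s w i) (x i + t *s w i) * cdot (x i + t *s w i) (x i + t *s w i))) (at t)"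
proof -
  have lin: "((\<lambda>t. (B *v (x i + t *s w i)) $ a) has_field_derivative (B *v w i) $ a) (at t)" for a
    unfolding matrix_vector_right_distrib vector_scalar_commute vector_add_component vector_smult_component
    by (auto intro!: derivative_eq_intros)
  have quad: "((\<lambda>t. cdot (x i + t *s w i) (x i + t *s w i)) has_field_derivative
      2 * cdot (x i + t *s w i) (w i)) (at t)"
    unfolding cdot_add cdot_scale cdot_commute[of "w i" "x i"]
    by (auto intro!: derivative_eq_intros simp: algebra_simps)
  show ?thesis
    unfolding bilin_pt[OF i] using N
    by (intro DERIV_cong[OF DERIV_divide[OF DERIV_mult[OF lin lin] quad]]) (auto simp: algebra_simps)
qed

text \<open>The curve through the classes of the \<open>x i\<close> whose velocity at 0 represents
  \<open>w i\<close> modulo \<open>x i\<close> in each factor and \<open>\<sigma>\<close> on the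
  line.\<close>

definition curve_at :: "(nat \<Rightarrow> complex ^ 3) \<Rightarrow> (nat \<Rightarrow> complex ^ 3) \<Rightarrow> complex \<Rightarrow> complex \<Rightarrow> nat \<Rightarrow> complex"
  where "curve_at x w \<sigma> t = pt (\<lambda>i. x i + t *s w i) (t * \<sigma>)"

lemma curve_in_X:
  "(\<And>i. i < m \<Longrightarrow> cdot (x i + t *s w i) (x i + t *s w i) \<noteq> 0) \<Longrightarrow> (p = 0 \<Longrightarrow> \<sigma> = 0) \<Longrightarrow>
    curve_at x w \<sigma> t \<in> X"
  unfolding curve_at_def by (rule pt_in_X) auto

lemma entry_curve: "entry (curve_at x w \<sigma> t) m 1 1 = t * \<sigma>"
  by (simp add: curve_at_def entry_pt)

lemma curve_deriv:
  assumes f: "f \<in> holomorphic_functions atlas" and A: "A \<in> frames"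
    and dom: "curve_at x w \<sigma> t \<in> domain A"
    and N: "\<And>i. i < m \<Longrightarrow> cdot (x i + t *s w i) (x i + t *s w i) \<noteq> 0" and \<sigma>: "p = 0 \<Longrightarrow> \<sigma> = 0"
    and G: "\<And>k. ((\<lambda>t. coords A (curve_at x w \<sigma> t) $ k) has_field_derivative G $ k) (at t)"
  shows "((\<lambda>t. f (curve_at x w \<sigma> t)) has_field_derivative
    frechet_derivative (\<lambda>u. f (inv_into (domain A) (coords A) u)) (at (coords A (curve_at x w \<sigma> t))) G) (at t)"
proof -
  let ?h = "\<lambda>u. f (inv_into (domain A) (coords A) u)"
  let ?c = "curve_at x w \<sigma>"
  have u: "coords A (?c t) \<in> range_dom"
    by (rule coords(1)[OF A dom])
  then obtain f' where f': "(?h has_derivative f') (at (coords A (?c t)))" "Vector_Spaces.linear (*s) (*) f'"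
    using f A unfolding holomorphic_functions_atlas hol_at_def comp_def by blast
  have fr: "f' = frechet_derivative ?h (at (coords A (?c t)))"
    using f'(1) by (rule frechet_derivative_at)
  have lin: "linear (\<lambda>h::complex. h *s G)"
    by (rule linearI) (auto simp: vec_eq_iff algebra_simps)
  have "((\<lambda>t. coords A (?c t)) has_derivative (\<lambda>h. h *s G)) (at t)"
  proof (rule has_derivative_vecI)
    show "bounded_linear (\<lambda>h::complex. h *s G)"
      using lin by (simp only: linear_conv_bounded_linear)
    have "(\<lambda>h. (h *s G) $ k) = (*) (G $ k)" for k
      by (auto simp: mult.commute)
    then show "((\<lambda>t. coords A (?c t) $ k) has_derivative (\<lambda>h. (h *s G) $ k)) (at t)" for k
      using G[of k] by (simp only: has_field_derivative_def)
  qed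
  then have "((\<lambda>t. ?h (coords A (?c t))) has_derivative (\<lambda>h. f' (h *s G))) (at t)"
    using f'(1) by (rule has_derivative_compose)
  moreover have "(\<lambda>h. f' (h *s G)) = (*) (f' G)"
    using f'(2) unfolding clinear_iff by (simp add: fun_eq_iff mult.commute)
  ultimately have "((\<lambda>t. ?h (coords A (?c t))) has_field_derivative f' G) (at t)"
    by (simp only: has_field_derivative_def)
  \<comment> \<open>The chart and its inverse cancel only inside the domain, where the curve stays
    for nearby parameters by continuity.\<close>
  moreover have "\<forall>\<^sub>F t' in nhds t. ?h (coords A (?c t')) = f (?c t')"
  proof -
    have "\<forall>\<^sub>F t' in nhds t. \<forall>i\<in>{..<m}. cdot (x i + t' *s w i) (x i + t' *s w i) \<noteq> 0 \<and>
        Re (bilin (A i) (?c t') i 1 1) > 1 / 2"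
    proof (intro eventually_ball_finite ballI eventually_conj finite_lessThan)
      fix i assume "i \<in> {..<m}"
      then have i: "i < m" by simp
      have "isCont (\<lambda>t. cdot (x i + t *s w i) (x i + t *s w i)) t"
        unfolding cdot_add cdot_scale by (intro continuous_intros)
      then show "\<forall>\<^sub>F t' in nhds t. cdot (x i + t' *s w i) (x i + t' *s w i) \<noteq> 0"
        using N[OF i] unfolding isCont_def eventually_nhds_conv_at
        by (intro conjI tendsto_imp_eventually_ne)
      have "isCont (\<lambda>t. bilin (A i) (?c t) i 1 1) t"
        unfolding curve_at_def using bilin_curve_deriv[where x = x and w = w, OF i N[OF i]] by (rule DERIV_isCont)
      then have "isCont (\<lambda>t. Re (bilin (A i) (?c t) i 1 1)) t"
        by (rule isCont_Re)
      moreover have "Re (bilin (A i) (?c t) i 1 1) > 1 / 2"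
        using dom i by (auto simp: domain_def)
      ultimately show "\<forall>\<^sub>F t' in nhds t. Re (bilin (A i) (?c t') i 1 1) > 1 / 2"
        unfolding isCont_def eventually_nhds_conv_at by (intro conjI order_tendstoD(1))
    qed
    then show ?thesis
    proof (rule eventually_mono)
      fix t' assume t': "\<forall>i\<in>{..<m}. cdot (x i + t' *s w i) (x i + t' *s w i) \<noteq> 0 \<and>
        Re (bilin (A i) (?c t') i 1 1) > 1 / 2"
      then have "?c t' \<in> domain A"
        unfolding domain_def using curve_in_X[of x t' w \<sigma>] \<sigma> by auto
      then show "?h (coords A (?c t')) = f (?c t')"
        using coords[OF A] inv_coords[OF A] by simp
    qed
  qed
  ultimately show ?thesis
    unfolding fr by (subst DERIV_cong_ev[OF refl _ refl, symmetric]) auto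
qed

lemma coords_curve_deriv:
  assumes "\<And>i. i < m \<Longrightarrow> cdot (x i + t *s w i) (x i + t *s w i) \<noteq> 0"
  shows "\<exists>G. \<forall>k. ((\<lambda>t. coords A (curve_at x w \<sigma> t) $ k) has_field_derivative G $ k) (at t)"
proof -
  have "\<exists>g. ((\<lambda>t. coords A (curve_at x w \<sigma> t) $ k) has_field_derivative g) (at t)" for k
  proof (cases "\<iota> k < 2 * m")
    case True
    then have i: "\<iota> k div 2 < m" by auto
    have eq: "(\<lambda>t. coords A (curve_at x w \<sigma> t) $ k) = (\<lambda>t. bilin (A (\<iota> k div 2))
        (pt (\<lambda>i. x i + t *s w i) (t * \<sigma>)) (\<iota> k div 2) 1 (if even (\<iota> k) then 2 else 3))"
      using True by (simp add: coords_def curve_at_def)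
    show ?thesis
      unfolding eq by (rule exI, rule bilin_curve_deriv[where x = x and w = w and t = t, OF i assms[OF i]])
  next
    case False
    have "((\<lambda>t. t * \<sigma>) has_field_derivative \<sigma>) (at t)"
      by (auto intro!: derivative_eq_intros)
    then show ?thesis
      using False by (auto simp: coords_def entry_curve)
  qed
  then obtain g where "\<And>k. ((\<lambda>t. coords A (curve_at x w \<sigma> t) $ k) has_field_derivative g k) (at t)"
    by metis
  then show ?thesis
    by (intro exI[of _ "\<chi> k. g k"]) simp
qed

lemma curve_differentiable:
  assumes f: "f \<in> holomorphic_functions atlas"
    and N: "\<And>i. i < m \<Longrightarrow> cdot (x i + t *s w i) (x i + t *s w i) \<noteq> 0" and \<sigma>: "p = 0 \<Longrightarrow> \<sigma> = 0"
  shows "(\<lambda>t. f (curve_at x w \<sigma> t)) field_differentiable at t"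
proof -
  obtain A where A: "A \<in> frames" "curve_at x w \<sigma> t \<in> domain A"
    using curve_in_X[OF N \<sigma>] by (rule X_domainE) auto
  obtain G where G: "\<And>k. ((\<lambda>t. coords A (curve_at x w \<sigma> t) $ k) has_field_derivative G $ k) (at t)"
    using coords_curve_deriv[where x = x and w = w and t = t, OF N] by blast
  show ?thesis
    using curve_deriv[where x = x and w = w and t = t, OF f A N \<sigma> G] by (auto simp: field_differentiable_def)
qed

text \<open>Injectivity of the differential makes the velocity zero in the chart. A tangent vector
  determines \<open>w i\<close> only modulo \<open>x i\<close>, and orthogonality to the
  nonisotropic \<open>x i\<close> removes this ambiguity.\<close>

lemma immersion_curve:
  assumes F: "holomorphic_immersion atlas N F"
    and x: "\<And>i. i < m \<Longrightarrow> cdot (x i) (x i) \<noteq> 0" and \<sigma>: "p = 0 \<Longrightarrow> \<sigma> = 0"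
    and w: "\<And>i. i < m \<Longrightarrow> cdot (x i) (w i) = 0"
    and deriv: "\<And>k. k < N \<Longrightarrow> deriv (\<lambda>t. F (curve_at x w \<sigma> t) k) 0 = 0"
  shows "(\<forall>i<m. w i = 0) \<and> \<sigma> = 0"
proof -
  define l where "l = (\<lambda>i. csqrt (cdot (x i) (x i)))"
  define z where "z = (\<lambda>i. inverse (l i) *s x i)"
  have l: "l i \<noteq> 0" "l i * l i = cdot (x i) (x i)" if "i < m" for i
    using x[OF that] power2_csqrt[of "cdot (x i) (x i)"] by (auto simp: l_def power2_eq_square)
  have z: "cdot (z i) (z i) = 1" "x i = l i *s z i" if "i < m" for i
    using l[OF that] x[OF that] by (auto simp: z_def field_simps)
  obtain A c where A: "A \<in> frames" and c: "\<And>i. i < m \<Longrightarrow> (c i)\<^sup>2 = 1 \<and> A i $ 1 = c i *s z i"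
    and dz: "\<And>s. (p = 0 \<longrightarrow> s = 0) \<Longrightarrow> pt z s \<in> domain A"
    using frame_exists[of z] z(1) by blast
  have O: "orthogonal_mat (A i)" if "i < m" for i
    using A that by (auto simp: frames_def)
  have c0: "c i \<noteq> 0" if "i < m" for i
    using c[OF that] by auto
  have row1: "(A i *v v) $ 1 = c i * cdot (z i) v" if "i < m" for i v
  proof -
    have "(A i *v v) $ 1 = cdot (A i $ 1) v"
      by (simp add: matrix_vector_mult_def cdot_def)
    then show ?thesis
      using c[OF that] by simp
  qed
  have "pt x 0 = pt z 0"
    using l(1) z(2) by (intro pt_scale[where c = l]) blast
  then have "curve_at x w \<sigma> 0 \<in> domain A"
    using dz[of 0] by (simp add: curve_at_def)
  moreover have N: "cdot (x i + 0 *s w i) (x i + 0 *s w i) \<noteq> 0" if "i < m" for i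
    using x[OF that] by simp
  moreover obtain G where G: "\<And>k. ((\<lambda>t. coords A (curve_at x w \<sigma> t) $ k) has_field_derivative G $ k) (at 0)"
    using coords_curve_deriv[where x = x and w = w and t = 0, OF N] by blast
  moreover have Fk: "(\<lambda>q. F q k) \<in> holomorphic_functions atlas" if "k < N" for k
    using F that by (auto simp: holomorphic_immersion_def)
  ultimately have D: "frechet_derivative (\<lambda>u. F (inv_into (domain A) (coords A) u) k)
      (at (coords A (curve_at x w \<sigma> 0))) G = 0" if "k < N" for k
    using DERIV_imp_deriv[OF curve_deriv[where x = x and w = w and t = 0, OF Fk[OF that] A _ N \<sigma> G]] deriv[OF that]
    by simp
  have D0: "frechet_derivative (\<lambda>u. F (inv_into (domain A) (coords A) u) k)
      (at (coords A (curve_at x w \<sigma> 0))) 0 = 0" if "k < N" for k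
  proof -
    have "coords A (curve_at x w \<sigma> 0) \<in> range_dom"
      by (rule coords(1)[OF A]) fact
    then have "(\<lambda>u. F (inv_into (domain A) (coords A) u) k) differentiable at (coords A (curve_at x w \<sigma> 0))"
      using Fk[OF that] A unfolding holomorphic_functions_atlas hol_at_def comp_def differentiable_def
      by blast
    then show ?thesis
      using linear_frechet_derivative linear_0 by blast
  qed
  have "inj (\<lambda>h. \<lambda>k\<in>{..<N}. frechet_derivative (\<lambda>u. F (inv_into (domain A) (coords A) u) k)
      (at (coords A (curve_at x w \<sigma> 0))) h)"
    using F A \<open>curve_at x w \<sigma> 0 \<in> domain A\<close> by (fastforce simp: holomorphic_immersion_def atlas_def)
  then have "G = 0"
    by (rule injD) (auto simp: restrict_def D D0)
  \<comment> \<open>In the adapted frame \<open>A x\<close> is a nonzero multiple of the first unit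
    vector, so the derivative of the coordinate with index \<open>b\<close> vanishes only if
    \<open>(A w)\<^sub>b\<close> does.\<close>
  have zero: "(A i *v w i) $ b = 0" if i: "i < m" and b: "b \<in> {2, 3}" for i b
  proof -
    define k where "k = inv \<iota> (if b = 2 then 2 * i else 2 * i + 1)"
    have k: "\<iota> k = (if b = 2 then 2 * i else 2 * i + 1)"
      unfolding k_def using i by (intro iota_slot) auto
    have "(\<lambda>t. coords A (curve_at x w \<sigma> t) $ k) =
        (\<lambda>t. bilin (A i) (pt (\<lambda>i. x i + t *s w i) (t * \<sigma>)) i 1 b)"
      using i b by (auto simp: coords_def k curve_at_def)
    then have "((\<lambda>t. bilin (A i) (pt (\<lambda>i. x i + t *s w i) (t * \<sigma>)) i 1 b) has_field_derivative 0) (at 0)"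
      using G[of k] \<open>G = 0\<close> by simp
    moreover note bilin_curve_deriv[where x = x and w = w, OF i N[OF i], of "A i" \<sigma> 1 b]
    ultimately have e: "(A i *v w i) $ 1 * (A i *v x i) $ b + (A i *v x i) $ 1 * (A i *v w i) $ b = 0"
      using DERIV_unique x[OF i] w[OF i] by fastforce
    have "A i *v (transpose (A i) *v axis 1 1) = axis 1 1"
      by (rule orthogonal_mat_inverse[OF O[OF i]])
    moreover have "transpose (A i) *v axis 1 1 = c i *s z i"
    proof -
      have "transpose (A i) *v axis 1 1 = A i $ 1"
        by (simp add: vec_eq_iff matrix_vector_mult_def axis_def transpose_def if_distrib[of "\<lambda>x. _ * x"]
            cong: if_cong)
      then show ?thesis
        using c[OF i] by (simp only:)
    qed
    ultimately have "c i *s (A i *v z i) = axis 1 1"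
      by (simp only: vector_scalar_commute)
    then have "(c i *s (A i *v z i)) $ b = 0"
      using b by (auto simp: axis_def)
    then have "c i * (A i *v z i) $ b = 0"
      by simp
    then have "(A i *v x i) $ b = 0"
      using c0[OF i] z(2)[OF i] by (simp add: vector_scalar_commute)
    moreover have "(A i *v x i) $ 1 \<noteq> 0"
      using row1[OF i, of "x i"] c0[OF i] l[OF i] z[OF i] by (metis cdot_scale(2) mult.right_neutral no_zero_divisors)
    ultimately show ?thesis
      using e by simp
  qed
  have "w i = 0" if i: "i < m" for i
  proof -
    have "cdot (z i) (w i) = 0"
      using w[OF i] by (simp add: z_def)
    then have "(A i *v w i) $ 1 = 0"
      by (simp add: row1[OF i])
    with zero[OF i] have "A i *v w i = 0"
      by (simp add: vec_eq_iff forall_3)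
    then have "transpose (A i) *v (A i *v w i) = 0"
      by (simp only: matrix_vector_mult_0_right)
    then show ?thesis
      by (simp only: orthogonal_mat_inverse(2)[OF O[OF i]])
  qed
  moreover have "\<sigma> = 0"
  proof (cases "p = 0")
    case False
    with p have "p = 1" by simp
    define k where "k = inv \<iota> (2 * m)"
    have "\<iota> k = 2 * m"
      unfolding k_def using \<open>p = 1\<close> by (intro iota_slot) auto
    then have "(\<lambda>t. coords A (curve_at x w \<sigma> t) $ k) = (\<lambda>t. t * \<sigma>)"
      by (simp add: coords_def entry_curve)
    then have "((\<lambda>t. t * \<sigma>) has_field_derivative 0) (at 0)"
      using G[of k] \<open>G = 0\<close> by simp
    moreover have "((\<lambda>t. t * \<sigma>) has_field_derivative \<sigma>) (at 0)"
      by (auto intro!: derivative_eq_intros)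
    ultimately show ?thesis
      by (rule DERIV_unique[symmetric])
  qed (rule \<sigma>)
  ultimately show ?thesis
    by blast
qed

section \<open>Tangent vectors over a product of spheres\<close>

text \<open>The first \<open>m\<close> spheres cover real projective planes. The last one would be
  the unit sphere for the \<open>4 m + p\<close> complex numbers \<open>yval\<close>; one real
  coordinate is dropped, so that the total dimension \<open>2 (5 m + p - 1)\<close> is twice the
  largest number \<open>2 m + N\<close> of complex equations with
  \<open>N < 3 m + p\<close>.\<close>

definition dims :: "nat \<Rightarrow> nat" where
  "dims i = (if i < m then 2 else if i = m then 8 * m + 2 * p - 2 else 0)"

definition params :: "point set" where
  "params = spheres (m + 1) dims"

definition xvec :: "point \<Rightarrow> nat \<Rightarrow> complex ^ 3" where
  "xvec c i = vector [of_real (c i 0), of_real (c i 1), of_real (c i 2)]"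

definition yval :: "point \<Rightarrow> nat \<Rightarrow> complex" where
  "yval c e = of_real (c m (2 * e)) + \<i> * of_real (c m (2 * e + 1))"

text \<open>For each factor four of the free numbers pass through two invertible 2 by 2 matrices.
  Three of the results form the tangent representative; the fourth reappears as an equation in
  \<open>system\<close>.\<close>

definition wvec :: "point \<Rightarrow> nat \<Rightarrow> complex ^ 3" where
  "wvec c i = vector
     [quat1 (xvec c i) (yval c (4 * i)) (yval c (4 * i + 1)),
      quat2 (xvec c i) (yval c (4 * i)) (yval c (4 * i + 1)),
      quat1 (xvec c i) (yval c (4 * i + 2)) (yval c (4 * i + 3))]"

definition curve :: "point \<Rightarrow> complex \<Rightarrow> nat \<Rightarrow> complex" where
  "curve c = curve_at (xvec c) (wvec c) (yval c (4 * m))"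

lemma params_bound:
  assumes "c \<in> params"
  shows "\<bar>c i j\<bar> \<le> 1"
proof (cases "i < m + 1 \<and> j \<le> dims i")
  case True
  then have "\<bar>c i j\<bar> \<le> (\<Sum>j\<le>dims i. \<bar>c i j\<bar>)"
    by (intro member_le_sum) auto
  then show ?thesis
    using assms True by (auto simp: params_def spheres_def)
next
  case False
  then have "c i j = 0"
    using assms by (cases "i < m + 1") (auto simp: params_def spheres_def)
  then show ?thesis
    by simp
qed

lemma params_sum: "c \<in> params \<Longrightarrow> i < m \<Longrightarrow> \<bar>c i 0\<bar> + \<bar>c i 1\<bar> + \<bar>c i 2\<bar> = 1"
  by (auto simp: params_def spheres_def dims_def numeral_2_eq_2 dest!: spec[of _ i])

text \<open>Cauchy-Schwarz turns norm 1 for the sum of absolute values into a Euclidean square of at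
  least 1/3.\<close>

lemma xvec_square:
  assumes "c \<in> params" "i < m"
  shows "cdot (xvec c i) (xvec c i) = of_real ((c i 0)\<^sup>2 + (c i 1)\<^sup>2 + (c i 2)\<^sup>2)"
    "(c i 0)\<^sup>2 + (c i 1)\<^sup>2 + (c i 2)\<^sup>2 \<ge> 1 / 3"
proof -
  show "cdot (xvec c i) (xvec c i) = of_real ((c i 0)\<^sup>2 + (c i 1)\<^sup>2 + (c i 2)\<^sup>2)"
    by (simp add: cdot_def sum_3 xvec_def power2_eq_square)
  have "(x + y + z)\<^sup>2 \<le> 3 * (x\<^sup>2 + y\<^sup>2 + z\<^sup>2)" for x y z :: real
    using sum_squares_ge_zero[of "x - y" "y - z"] zero_le_square[of "x - z"]
    by (simp add: power2_eq_square algebra_simps)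
  from this[of "\<bar>c i 0\<bar>" "\<bar>c i 1\<bar>" "\<bar>c i 2\<bar>"]
  show "(c i 0)\<^sup>2 + (c i 1)\<^sup>2 + (c i 2)\<^sup>2 \<ge> 1 / 3"
    unfolding params_sum[OF assms] by simp
qed

lemma xvec_bound: "c \<in> params \<Longrightarrow> cmod (xvec c i $ j) \<le> 1"
  using exhaust_3[of j] by (auto simp: xvec_def params_bound)

lemma yval_bound:
  assumes "c \<in> params"
  shows "cmod (yval c e) \<le> 2"
proof -
  have "cmod (yval c e) \<le> \<bar>c m (2 * e)\<bar> + \<bar>c m (2 * e + 1)\<bar>"
    unfolding yval_def by (rule order_trans[OF norm_triangle_ineq]) (simp add: norm_mult)
  then show ?thesis
    using params_bound[OF assms, of m "2 * e"] params_bound[OF assms, of m "2 * e + 1"] by linarith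
qed

lemma wvec_bound:
  assumes c: "c \<in> params"
  shows "cmod (wvec c i $ j) \<le> 6"
proof -
  let ?x = "xvec c i"
  have x: "cmod (?x $ 1) \<le> 1" "cmod (?x $ 2 + \<i> * ?x $ 3) \<le> 2" "cmod (?x $ 2 - \<i> * ?x $ 3) \<le> 2"
  proof -
    have "cmod (?x $ 2) + cmod (?x $ 3) \<le> 2"
      using xvec_bound[OF c, of i 2] xvec_bound[OF c, of i 3] by linarith
    with xvec_bound[OF c, of i 1] show "cmod (?x $ 1) \<le> 1" "cmod (?x $ 2 + \<i> * ?x $ 3) \<le> 2"
      "cmod (?x $ 2 - \<i> * ?x $ 3) \<le> 2"
      using norm_triangle_ineq[of "?x $ 2" "\<i> * ?x $ 3"] norm_triangle_ineq4[of "?x $ 2" "\<i> * ?x $ 3"]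
      by (simp_all add: norm_mult)
  qed
  have "cmod (quat1 ?x u v) \<le> 6" "cmod (quat2 ?x u v) \<le> 6" if "cmod u \<le> 2" "cmod v \<le> 2" for u v
  proof -
    have "cmod (quat1 ?x u v) \<le> cmod (?x $ 1) * cmod u + cmod (?x $ 2 + \<i> * ?x $ 3) * cmod v"
      unfolding quat1_def by (rule order_trans[OF norm_triangle_ineq]) (simp add: norm_mult)
    also have "\<dots> \<le> 1 * 2 + 2 * 2"
      using that x by (intro add_mono mult_mono) auto
    finally show "cmod (quat1 ?x u v) \<le> 6"
      by simp
    have "cmod (quat2 ?x u v) \<le> cmod (?x $ 2 - \<i> * ?x $ 3) * cmod u + cmod (?x $ 1) * cmod v"
      unfolding quat2_def by (rule order_trans[OF norm_triangle_ineq4]) (simp add: norm_mult)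
    also have "\<dots> \<le> 2 * 2 + 1 * 2"
      using that x by (intro add_mono mult_mono) auto
    finally show "cmod (quat2 ?x u v) \<le> 6"
      by simp
  qed
  then show ?thesis
    using exhaust_3[of j] yval_bound[OF c] by (auto simp: wvec_def)
qed

lemma norm_cdot_le:
  assumes "\<And>j. cmod (x $ j) \<le> a" "\<And>j. cmod (y $ j) \<le> b"
  shows "cmod (cdot x y) \<le> 3 * (a * b)"
proof -
  have "0 \<le> a"
    using assms(1)[of 1] norm_ge_zero order_trans by blast
  have "cmod (cdot x y) \<le> (\<Sum>j\<in>(UNIV :: 3 set). cmod (x $ j * y $ j))"
    unfolding cdot_def by (rule norm_sum)
  also have "\<dots> \<le> (\<Sum>j\<in>(UNIV :: 3 set). a * b)"
    unfolding norm_mult using assms \<open>0 \<le> a\<close> by (intro sum_mono mult_mono) auto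
  finally show ?thesis
    by simp
qed

text \<open>The coordinates of \<open>x\<close> and \<open>w\<close> are bounded by 1 and 6, so
  \<open>x \<bullet> x\<close> changes by at most \<open>36 |t| + 108 |t|\<^sup>2\<close>. For
  \<open>|t| \<le> 1/200\<close> this is less than the lower bound 1/3.\<close>

lemma curve_nonzero:
  assumes c: "c \<in> params" and i: "i < m" and t: "cmod t \<le> 1 / 200"
  shows "cdot (xvec c i + t *s wvec c i) (xvec c i + t *s wvec c i) \<noteq> 0"
proof
  let ?x = "xvec c i" and ?w = "wvec c i"
  assume "cdot (?x + t *s ?w) (?x + t *s ?w) = 0"
  then have "cdot ?x ?x = - (2 * t * cdot ?x ?w + t * t * cdot ?w ?w)"
    by (simp add: cdot_add cdot_commute[of ?w ?x] add_eq_0_iff algebra_simps)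
  then have "cmod (cdot ?x ?x) \<le> cmod (2 * t * cdot ?x ?w) + cmod (t * t * cdot ?w ?w)"
    using norm_triangle_ineq by (metis norm_minus_cancel)
  also have "\<dots> = 2 * cmod t * cmod (cdot ?x ?w) + cmod t * cmod t * cmod (cdot ?w ?w)"
    by (simp add: norm_mult)
  also have "\<dots> \<le> 2 * (1 / 200) * (3 * (1 * 6)) + 1 / 200 * (1 / 200) * (3 * (6 * 6))"
    using t xvec_bound[OF c] wvec_bound[OF c]
    by (intro add_mono mult_mono norm_cdot_le) auto
  finally have "cmod (cdot ?x ?x) < 1 / 3"
    by simp
  then show False
    using xvec_square[OF c i] by (simp only: norm_of_real)
qed

lemma xvec_nonzero: "c \<in> params \<Longrightarrow> i < m \<Longrightarrow> cdot (xvec c i) (xvec c i) \<noteq> 0"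
  using curve_nonzero[of c i 0] by simp

text \<open>Types are nonempty; this keeps the truncated subtraction in \<open>dims\<close>
  exact.\<close>

lemma dim_pos: "0 < 2 * m + p"
  using iota_less[of undefined] by linarith

lemma params_zero: "c \<in> params \<Longrightarrow> i \<le> m \<Longrightarrow> dims i < j \<Longrightarrow> c i j = 0"
  by (auto simp: params_def spheres_def)

lemma yval_beyond:
  assumes "c \<in> params" "4 * m + p \<le> e"
  shows "yval c e = 0"
proof -
  have "dims m = 8 * m + 2 * p - 2"
    by (simp add: dims_def)
  then have "dims m < 2 * e"
    using assms(2) dim_pos by linarith
  then show ?thesis
    using params_zero[OF assms(1), of m] by (simp add: yval_def)
qed

lemma xvec_flip: "xvec (flip i c) k = (if k = i then - xvec c k else xvec c k)"
  by (simp add: xvec_def flip_def vec_eq_iff forall_3)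

lemma yval_flip: "yval (flip i c) e = (if i = m then - yval c e else yval c e)"
  by (simp add: yval_def flip_def)

lemma wvec_flip:
  assumes "k < m"
  shows "wvec (flip i c) k = (if k = i \<or> i = m then - wvec c k else wvec c k)"
  using assms by (simp add: wvec_def xvec_flip yval_flip vec_eq_iff forall_3)

text \<open>The vectors \<open>x i\<close> and \<open>w i\<close> change sign together, which does
  not affect the projective point.\<close>

lemma curve_flip: "i < m \<Longrightarrow> curve (flip i c) t = curve c t"
  unfolding curve_def curve_at_def
  by (auto simp: yval_flip xvec_flip wvec_flip vec_eq_iff
      intro!: pt_scale[where c = "\<lambda>k. if k = i then - 1 else 1"] split: if_splits)

text \<open>All \<open>w i\<close> and the velocity on the line change sign, which reverses
  time.\<close>

lemma curve_flip_last: "curve (flip m c) t = curve c (- t)"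
proof -
  have "pt (\<lambda>i. xvec (flip m c) i + t *s wvec (flip m c) i) s = pt (\<lambda>i. xvec c i + (- t) *s wvec c i) s" for s
    by (rule pt_scale[where c = "\<lambda>k. 1"]) (auto simp: xvec_flip wvec_flip vec_eq_iff)
  then show ?thesis
    by (simp add: curve_def curve_at_def yval_flip)
qed

lemma curve_field_differentiable:
  assumes "f \<in> holomorphic_functions atlas" "c \<in> params" "cmod t \<le> 1 / 200"
  shows "(\<lambda>t. f (curve c t)) field_differentiable at t"
  unfolding curve_def
  by (rule curve_differentiable[OF assms(1) curve_nonzero[OF assms(2) _ assms(3)] yval_beyond[OF assms(2)]]) simp_all

lemma continuous_on_xvec: "continuous_on S (\<lambda>c. xvec c i $ j)"
  using exhaust_3[of j] by (elim disjE; simp add: xvec_def; intro continuous_intros)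

lemma continuous_on_yval: "continuous_on S (\<lambda>c. yval c e)"
  unfolding yval_def by (intro continuous_intros)

lemma continuous_on_wvec: "continuous_on S (\<lambda>c. wvec c i $ j)"
proof -
  have "continuous_on S (\<lambda>c. quat1 (xvec c i) (yval c a) (yval c b))"
    "continuous_on S (\<lambda>c. quat2 (xvec c i) (yval c a) (yval c b))" for a b
    unfolding quat1_def quat2_def
    by (intro continuous_on_add continuous_on_diff continuous_on_mult continuous_on_const
        continuous_on_xvec continuous_on_yval)+
  then show ?thesis
    using exhaust_3[of j] by (elim disjE) (simp_all add: wvec_def)
qed

lemma continuous_on_curve:
  "continuous_on (params \<times> cball 0 (1 / 200)) (\<lambda>(c, t). curve c t)"
proof (rule continuous_on_coordinatewise_then_product)
  fix n
  obtain i j k where n: "decode n = (i, j, k)"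
    by (metis prod_cases3)
  let ?S = "params \<times> cball 0 (1 / 200 :: real)"
  have x: "continuous_on ?S (\<lambda>q. xvec (fst q) i $ j)" for i j
    by (rule continuous_on_compose2[OF continuous_on_xvec[of UNIV] continuous_on_fst[OF continuous_on_id]]) simp
  have w: "continuous_on ?S (\<lambda>q. wvec (fst q) i $ j)" for i j
    by (rule continuous_on_compose2[OF continuous_on_wvec[of UNIV] continuous_on_fst[OF continuous_on_id]]) simp
  have y: "continuous_on ?S (\<lambda>q. yval (fst q) (4 * m))"
    by (rule continuous_on_compose2[OF continuous_on_yval[of UNIV] continuous_on_fst[OF continuous_on_id]]) simp
  have z: "continuous_on ?S (\<lambda>q. (xvec (fst q) i + snd q *s wvec (fst q) i) $ j)" for i j
    unfolding vector_add_component vector_smult_component by (intro continuous_intros x w)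
  show "continuous_on ?S (\<lambda>q. (case q of (c, t) \<Rightarrow> curve c t) n)"
  proof (cases "i < m")
    case True
    have "continuous_on ?S (\<lambda>q. (xvec (fst q) i + snd q *s wvec (fst q) i) $ j *
        (xvec (fst q) i + snd q *s wvec (fst q) i) $ k /
        cdot (xvec (fst q) i + snd q *s wvec (fst q) i) (xvec (fst q) i + snd q *s wvec (fst q) i))"
      unfolding cdot_def[of "xvec (fst _) i + _" "xvec (fst _) i + _"]
      by (intro continuous_intros z) (use curve_nonzero[OF _ True] in \<open>auto simp: cdot_def\<close>)
    then show ?thesis
      using True by (simp add: curve_def curve_at_def pt_def n case_prod_unfold)
  next
    case False
    have "continuous_on ?S (\<lambda>q. snd q * yval (fst q) (4 * m))"
      by (intro continuous_intros y)
    then show ?thesis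
      using False by (simp add: curve_def curve_at_def pt_def n case_prod_unfold)
  qed
qed

section \<open>The equivariant system of equations\<close>

text \<open>The differential of \<open>f\<close> on the tangent vector given by \<open>c\<close>. As
  a derivative in one variable it is continuous in \<open>c\<close> by Cauchy's inequality.\<close>

definition tangent :: "((nat \<Rightarrow> complex) \<Rightarrow> complex) \<Rightarrow> point \<Rightarrow> complex" where
  "tangent f c = deriv (\<lambda>t. f (curve c t)) 0"

lemma continuous_on_tangent:
  assumes f: "f \<in> holomorphic_functions atlas"
  shows "continuous_on params (tangent f)"
  unfolding tangent_def
proof (rule continuous_on_deriv_parameter)
  show "compact params"
    unfolding params_def by (rule compact_spheres)
  have "curve c t \<in> X" if "c \<in> params" "cmod t \<le> 1 / 200" for c t
    unfolding curve_def
    by (rule curve_in_X[OF curve_nonzero[OF that(1) _ that(2)] yval_beyond[OF that(1)]]) simp_all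
  then have "continuous_on (params \<times> cball 0 (1 / 200)) (\<lambda>q. f (case q of (c, t) \<Rightarrow> curve c t))"
    by (intro continuous_on_compose2[OF continuous_on_holomorphic[OF f] continuous_on_curve]) auto
  then show "continuous_on (params \<times> cball 0 (1 / 200)) (\<lambda>(c, t). f (curve c t))"
    by (simp add: case_prod_unfold)
  show "(\<lambda>t. f (curve c t)) holomorphic_on ball 0 (1 / 200)" if "c \<in> params" for c
    unfolding holomorphic_on_def
  proof
    fix t :: complex assume "t \<in> ball 0 (1 / 200)"
    then have "(\<lambda>t. f (curve c t)) field_differentiable at t"
      by (intro curve_field_differentiable[OF f that]) simp
    then show "(\<lambda>t. f (curve c t)) field_differentiable at t within ball 0 (1 / 200)"
      by (rule field_differentiable_at_within)
  qed
qed simp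

lemma tangent_flip: "i < m \<Longrightarrow> tangent f (flip i c) = tangent f c"
  by (simp add: tangent_def curve_flip)

lemma tangent_flip_last:
  assumes f: "f \<in> holomorphic_functions atlas" and c: "c \<in> params"
  shows "tangent f (flip m c) = - tangent f c"
proof -
  have "((\<lambda>t. f (curve c t)) has_field_derivative tangent f c) (at (- 0))"
    unfolding tangent_def using curve_field_differentiable[OF f c, of 0]
    by (simp add: field_differentiable_derivI)
  then have "((\<lambda>t. f (curve c (- t))) has_field_derivative tangent f c * - 1) (at 0)"
    by (rule DERIV_chain2) (auto intro!: derivative_eq_intros)
  then show ?thesis
    unfolding tangent_def[of f "flip m c"] curve_flip_last by (simp add: DERIV_imp_deriv)
qed

text \<open>
  For fixed \<open>xvec c\<close> all components are complex linear in the numbers \<open>yval c\<close>. If \<open>F\<close> is an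
  immersion into \<open>N\<close>-space, they vanish simultaneously only if these numbers do: \<open>wvec c\<close> is then
  orthogonal to \<open>xvec c\<close> and, together with the last number, in the kernel of the differential of \<open>F\<close>.
\<close>

definition system :: "((nat \<Rightarrow> complex) \<Rightarrow> nat \<Rightarrow> complex) \<Rightarrow> nat \<Rightarrow> nat \<Rightarrow> point \<Rightarrow> complex" where
  "system F N e c =
    (if e < m then quat2 (xvec c e) (yval c (4 * e + 2)) (yval c (4 * e + 3))
     else if e < 2 * m then cdot (xvec c (e - m)) (wvec c (e - m))
     else if e < 2 * m + N then tangent (\<lambda>q. F q (e - 2 * m)) c else 0)"

text \<open>Real and imaginary parts are counted separately, so \<open>j\<close> belongs to
  component \<open>j div 2\<close> of \<open>system\<close>. All components are odd in the last
  factor; only the first \<open>m\<close> are also odd in a factor of their own, since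
  \<open>cdot (xvec c i) (wvec c i)\<close> is a product of two odd terms.\<close>

definition twist :: "nat \<Rightarrow> nat set" where
  "twist j = (if j < 2 * m then {j div 2, m} else {m})"

lemma continuous_on_system:
  assumes "\<And>k. k < N \<Longrightarrow> (\<lambda>q. F q k) \<in> holomorphic_functions atlas"
  shows "continuous_on params (system F N e)"
proof -
  consider "e < m" | "m \<le> e" "e < 2 * m" | "2 * m \<le> e" "e < 2 * m + N" | "2 * m + N \<le> e"
    by linarith
  then show ?thesis
  proof cases
    case 1
    then show ?thesis
      by (simp add: system_def quat2_def) (intro continuous_intros continuous_on_xvec continuous_on_yval)
  next
    case 2
    then show ?thesis
      by (simp add: system_def cdot_def) (intro continuous_intros continuous_on_xvec continuous_on_wvec)
  next
    case 3
    then have "system F N e = tangent (\<lambda>q. F q (e - 2 * m))"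
      by (auto simp: system_def)
    moreover have "(\<lambda>q. F q (e - 2 * m)) \<in> holomorphic_functions atlas"
      using 3 by (intro assms) simp
    ultimately show ?thesis
      by (simp add: continuous_on_tangent)
  next
    case 4
    then show ?thesis
      by (simp add: system_def)
  qed
qed

lemma system_flip:
  assumes "\<And>k. k < N \<Longrightarrow> (\<lambda>q. F q k) \<in> holomorphic_functions atlas" and c: "c \<in> params" and i: "i < m"
  shows "system F N e (flip i c) = (if i = e then - system F N e c else system F N e c)"
proof -
  have "cdot (- x) (- y) = cdot x y" for x y
    by (simp add: cdot_def)
  then show ?thesis
    using i by (simp add: system_def xvec_flip yval_flip wvec_flip tangent_flip)
qed

lemma system_flip_last:
  assumes F: "\<And>k. k < N \<Longrightarrow> (\<lambda>q. F q k) \<in> holomorphic_functions atlas" and c: "c \<in> params"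
  shows "system F N e (flip m c) = - system F N e c"
proof -
  have "cdot x (- y) = - cdot x y" for x y
    by (simp add: cdot_def sum_negf)
  moreover have "tangent (\<lambda>q. F q (e - 2 * m)) (flip m c) = - tangent (\<lambda>q. F q (e - 2 * m)) c"
    if "2 * m \<le> e" "e < 2 * m + N"
    using that by (intro tangent_flip_last F c) simp
  moreover have "e - m < m" if "\<not> e < m" "e < 2 * m"
    using that by linarith
  ultimately show ?thesis
    by (auto simp: system_def xvec_flip yval_flip wvec_flip)
qed

text \<open>For \<open>K \<ge> 2 m\<close> the polynomial is the product of all
  \<open>(a\<^sub>i + a\<^sub>m)\<^sup>2\<close> with a power of \<open>a\<^sub>m\<close>, and the
  coefficient is that of the squares of all \<open>a\<^sub>i\<close> times this power. The exponents
  are filled in the order of the factors, so exactly one index can be lowered at each step.\<close>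

lemma coef_twist:
  "coef twist (m + 1) K (\<lambda>i. if i < m then min 2 (K - 2 * i) else if i = m then K - 2 * m else 0) = 1"
proof (induction K)
  case (Suc K)
  define L where "L = (\<lambda>K i. if i < m then min 2 (K - 2 * i) else if i = m then K - 2 * m else (0::nat))"
  define a where "a = (if K < 2 * m then K div 2 else m)"
  have "{i. i < m + 1 \<and> 0 < L (Suc K) i \<and> i \<in> twist K} = {a}"
    by (auto simp: L_def twist_def a_def)
  moreover have "(L (Suc K))(a := L (Suc K) a - 1) = L K"
    by (auto simp: L_def a_def fun_eq_iff)
  moreover have "coef twist (m + 1) K (L K) = 1"
    using Suc.IH unfolding L_def .
  ultimately have "coef twist (m + 1) (Suc K) (L (Suc K)) = 1"
    unfolding coef.simps by simp
  then show ?case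
    unfolding L_def .
qed simp

theorem no_immersion:
  assumes N: "N < 3 * m + p"
  shows "\<not> holomorphic_immersion atlas N F"
proof
  assume F: "holomorphic_immersion atlas N F"
  then have Fk: "(\<lambda>q. F q k) \<in> holomorphic_functions atlas" if "k < N" for k
    using that by (auto simp: holomorphic_immersion_def)
  \<comment> \<open>Twice the \<open>5 m + p - 1\<close> complex components; those of index at least
    \<open>2 m + N\<close> are padding by zero.\<close>
  define K where "K = 2 * (5 * m + p - 1)"
  define f where "f = (\<lambda>j c. if even j then Re (system F N (j div 2) c) else Im (system F N (j div 2) c))"
  have dims: "dims = (\<lambda>i. if i < m then min 2 (K - 2 * i) else if i = m then K - 2 * m else 0)"
    using dim_pos by (auto simp: dims_def K_def fun_eq_iff)
  have "sum dims {..<m + 1} = (\<Sum>i<m. dims i) + dims m"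
    by simp
  also have "(\<Sum>i<m. dims i) = 2 * m"
    by (simp add: dims_def)
  also have "2 * m + dims m = K"
    using dim_pos by (simp add: dims_def K_def)
  finally have sum: "K = sum dims {..<m + 1}" ..
  have "\<exists>c\<in>spheres (m + 1) dims. \<forall>j<K. f j c = 0"
  proof (rule product_borsuk_ulam[OF sum, where \<tau> = twist])
    show "continuous_on (spheres (m + 1) dims) (f j)" for j
      using continuous_on_system[of N F "j div 2", OF Fk]
      by (cases "even j") (auto simp: f_def params_def intro!: continuous_intros)
    fix i j c
    assume i: "i < m + 1" and "c \<in> spheres (m + 1) dims"
    then have c: "c \<in> params"
      by (simp add: params_def)
    show "f j (flip i c) = (if i \<in> twist j then - f j c else f j c)"
    proof (cases "i = m")
      case True
      then show ?thesis
        by (simp add: f_def twist_def system_flip_last[OF Fk c])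
    next
      case False
      with i have "i < m" by simp
      moreover from this have "i \<in> twist j \<longleftrightarrow> i = j div 2"
        by (auto simp: twist_def)
      ultimately show ?thesis
        by (simp add: f_def system_flip[OF Fk c])
    qed
  next
    show "twist j \<subseteq> {..<m + 1}" for j
      by (auto simp: twist_def)
    show "odd (coef twist (m + 1) K dims)"
      unfolding dims coef_twist by simp
  qed
  then obtain c where c: "c \<in> params" and zero: "\<And>j. j < K \<Longrightarrow> f j c = 0"
    by (auto simp: params_def)
  have out: "system F N e c = 0" if "e < 5 * m + p - 1" for e
    using zero[of "2 * e"] zero[of "2 * e + 1"] that by (simp add: f_def K_def complex_eq_iff)
  have "(\<forall>i<m. wvec c i = 0) \<and> yval c (4 * m) = 0"
  proof (rule immersion_curve[OF F xvec_nonzero[OF c]])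
    show "yval c (4 * m) = 0" if "p = 0"
      using that by (intro yval_beyond[OF c]) simp
    show "cdot (xvec c i) (wvec c i) = 0" if "i < m" for i
      using out[of "m + i"] that by (simp add: system_def)
    show "deriv (\<lambda>t. F (curve_at (xvec c) (wvec c) (yval c (4 * m)) t) k) 0 = 0" if "k < N" for k
      using out[of "2 * m + k"] that N by (simp add: system_def tangent_def curve_def)
  qed
  then have w: "\<And>i. i < m \<Longrightarrow> wvec c i = 0" and y: "yval c (4 * m) = 0"
    by auto
  \<comment> \<open>Three of the four equations come from \<open>wvec c i = 0\<close>, the fourth
    from the first components of \<open>system\<close>; both matrices are invertible at the real
    vector \<open>xvec c i\<close>.\<close>
  have quad: "yval c (4 * i) = 0 \<and> yval c (4 * i + 1) = 0 \<and> yval c (4 * i + 2) = 0 \<and> yval c (4 * i + 3) = 0"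
    if i: "i < m" for i
  proof -
    have "quat1 (xvec c i) (yval c (4 * i)) (yval c (4 * i + 1)) = 0"
      "quat2 (xvec c i) (yval c (4 * i)) (yval c (4 * i + 1)) = 0"
      "quat1 (xvec c i) (yval c (4 * i + 2)) (yval c (4 * i + 3)) = 0"
      using w[OF i] by (simp_all add: wvec_def vec_eq_iff forall_3)
    moreover have "quat2 (xvec c i) (yval c (4 * i + 2)) (yval c (4 * i + 3)) = 0"
      using out[of i] i by (simp add: system_def)
    ultimately show ?thesis
      using quat_eq_0 xvec_nonzero[OF c i] by blast
  qed
  have low: "yval c e = 0" if "e < 4 * m" for e
  proof -
    have "e div 4 < m" using that by auto
    moreover have "e = 4 * (e div 4) \<or> e = 4 * (e div 4) + 1 \<or> e = 4 * (e div 4) + 2 \<or> e = 4 * (e div 4) + 3"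
      by linarith
    ultimately show ?thesis
      using quad[of "e div 4"] by metis
  qed
  have "yval c e = 0" for e
  proof -
    consider "e < 4 * m" | "e = 4 * m" | "4 * m + p \<le> e"
      using p by linarith
    then show ?thesis
      using low y yval_beyond[OF c] by cases auto
  qed
  \<comment> \<open>The real and imaginary parts of all \<open>yval c e\<close> exhaust the
    coordinates of the last factor, which lies on a sphere.\<close>
  then have "c m j = 0" for j
    using complex_eq_iff[of "yval c (j div 2)" 0] by (cases "even j") (auto simp: yval_def elim!: evenE oddE)
  moreover have "(\<Sum>j\<le>dims m. \<bar>c m j\<bar>) = 1"
    using c by (auto simp: params_def spheres_def)
  ultimately show False
    by simp
qed

end

section \<open>The dimension bound for arbitrary n\<close>

theorem theorem5p1:
  "\<exists>(X :: (nat \<Rightarrow> complex) topology) (A :: (nat \<Rightarrow> complex, 'n::finite) chart set).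
     stein_manifold X A \<and>
     (\<forall>N::nat. int N < \<lfloor>3 * real CARD('n) / 2\<rfloor> \<longrightarrow> (\<nexists>F. holomorphic_immersion A N F))"
proof -
  define m p where "m = CARD('n) div 2" and "p = CARD('n) mod 2"
  have n: "CARD('n) = 2 * m + p" and p: "p \<le> 1"
    by (auto simp: m_def p_def)
  obtain \<iota> :: "'n \<Rightarrow> nat" where "bij_betw \<iota> UNIV {..<2 * m + p}"
    using ex_bij_betw_finite_nat[of "UNIV :: 'n set"] by (auto simp: n atLeast0LessThan)
  then interpret conic_complement m p \<iota>
    using p by unfold_locales
  \<comment> \<open>For \<open>n = 2 m + p\<close> with \<open>p \<le> 1\<close> the integer part of
    \<open>3 n / 2\<close> is \<open>3 m + p\<close>.\<close>
  have "N < 3 * m + p" if "int N < \<lfloor>3 * real CARD('n) / 2\<rfloor>" for N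
  proof -
    have "int N + 1 \<le> \<lfloor>3 * real CARD('n) / 2\<rfloor>"
      using that by simp
    then have "real N + 1 \<le> 3 * real CARD('n) / 2"
      by (simp add: le_floor_iff)
    then have "real N < 3 * real m + real p"
      using p unfolding n by simp
    then show ?thesis
      by linarith
  qed
  then show ?thesis
    using stein_manifold_atlas no_immersion
    by (intro exI[of _ "top_of_set X"] exI[of _ atlas]) blast
qed

end
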